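(* Let $2\le d<\infty$ and let $S_i$, $\tilde S_i$ ($i=1,\dots,d$) be representations of the Cuntz algebra $\mathcal{O}_d$ on separable Hilbert spaces $$\mathcal{H}=\int_{\Omega}^{\oplus}\mathcal{H}(x)\,d\mu(x)\quad\text{and}\quad\widetilde{\mathcal{H}}=\int_{\Omega}^{\oplus}\widetilde{\mathcal{H}}(x)\,d\tilde\mu(x),$$ in the standard form described in the context, with unitary fields $U(x)$ and $\tilde U(x)$ respectively. Partition $\Omega$ into three $\sigma$-invariant Borel sets $\Omega=\Omega_0\cup\Omega_1\cup\Omega_2$ such that $\mu$ and $\tilde\mu$ are equivalent on $\Omega_0$, $\tilde\mu(\Omega_1)=0$ and $\mu(\Omega_2)=0$. Then an operator $T\in\mathcal{B}(\mathcal{H},\widetilde{\mathcal{H}})$ is an intertwiner between the two representations, i.e. $TS_i=\tilde S_iT$ for $i=1,\dots,d$, if and only if $T$ has a measurable decomposition $$T=\int_{\Omega_0}^{\oplus}T(x)\,d\mu(x)$$ where $T(x)\in\mathcal{B}(\mathcal{H}(x),\widetilde{\mathcal{H}}(x))$ and $$T(x)U(x)=\tilde U(x)T(\sigma(x))$$ for almost all $x\in\Omega_0$.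
   Context: $\mathcal{O}_d$ is the universal unital $C^*$-algebra generated by $s_1,\dots,s_d$ with $s_i^*s_j=\delta_{ij}1$, $\sum_i s_is_i^*=1$. $\Omega=\prod_1^\infty\{1,\dots,d\}$, $\sigma(x_1,x_2,\dots)=(x_2,x_3,\dots)$, $\sigma_i(x_1,x_2,\dots)=(i,x_1,x_2,\dots)$, $\Omega$ carries its Borel structure. A probability measure $\mu$ is $\sigma_i$-quasi-invariant if $\mu(E)=0\Rightarrow\mu(\sigma_i^{-1}(E))=0$, and $\sigma$-quasi-invariant if $\mu(E)=0\Rightarrow\mu(\sigma^{-1}(E))=0$, for all Borel $E$. A Borel set $E$ is $\sigma$-invariant if $\sigma^{-1}(E)=E$. Standard form: $\mu$ is a probability measure on $\Omega$ that is $\sigma$-quasi-invariant and $\sigma_i$-quasi-invariant for all $i$; $x\mapsto\mathcal{H}(x)$ is a measurable field of Hilbert spaces with $\dim\mathcal{H}(x)=\dim\mathcal{H}(\sigma(x))$ a.e., so that $\mathcal{H}(x)$ is identified with a fixed Hilbert space $\mathcal{H}_n$ on each set $\{x:\dim\mathcal{H}(x)=n\}$ (hence $\mathcal{H}(x)$ and $\mathcal{H}(\sigma(x))$ are identified); $x\mapsto U(x)$ is a measurable field of unitary operators; and $$(S_i\xi)(x)=\chi_i(x)\rho(x)U(x)\xi(\sigma(x)),$$ where $\chi_i(x)=1$ if $x_1=i$ and $0$ otherwise, and $\rho(x)^2=d\mu(\sigma(x))/d\mu(x)$ is the local Radon-Nikodym derivative (on $\sigma_i(\Omega)$, the derivative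 of $E\mapsto\mu(\sigma(E))$ with respect to $\mu$). Similarly for $\tilde S_i$ with $\tilde\mu,\tilde\rho,\tilde U,\widetilde{\mathcal{H}}(x)$. In the decomposition of $T$: on $\Omega_0$ the space $\int_{\Omega_0}^\oplus\widetilde{\mathcal{H}}(x)\,d\tilde\mu(x)$ is canonically identified with $\int_{\Omega_0}^\oplus\widetilde{\mathcal{H}}(x)\,d\mu(x)$ by multiplication with $(d\tilde\mu/d\mu)^{1/2}$, and $T=\int_{\Omega_0}^\oplus T(x)\,d\mu(x)$ means that $T$ vanishes on the part of $\mathcal{H}$ over $\Omega_1$, has range in the part of $\widetilde{\mathcal{H}}$ over $\Omega_0$, and acts as $(T\xi)(x)=T(x)\xi(x)$ on $\Omega_0$ under this identification. *)

theory Defs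
  imports "HOL-Probability.Probability"
begin

section \<open>Complex Hilbert spaces\<close>

text \<open>The inner product is conjugate linear in the first and linear in the second argument. Its
  real part is the inner product of the underlying real Hilbert space, so that norm, topology
  and Borel sets are those of the library.\<close>

class chilbert_space = real_inner + complete_space +
  fixes scaleC :: "complex \<Rightarrow> 'a \<Rightarrow> 'a" (infixr "*\<^sub>C" 75)
    and cinner :: "'a \<Rightarrow> 'a \<Rightarrow> complex"
  assumes scaleC_add_right: "a *\<^sub>C (x + y) = a *\<^sub>C x + a *\<^sub>C y"
    and scaleC_add_left: "(a + b) *\<^sub>C x = a *\<^sub>C x + b *\<^sub>C x"
    and scaleC_scaleC: "a *\<^sub>C b *\<^sub>C x = (a * b) *\<^sub>C x"
    and scaleR_eq_scaleC: "r *\<^sub>R x = complex_of_real r *\<^sub>C x"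
    and cinner_commute: "cinner x y = cnj (cinner y x)"
    and cinner_add_right: "cinner x (y + z) = cinner x y + cinner x z"
    and cinner_scaleC_right: "cinner x (a *\<^sub>C y) = a * cinner x y"
    and inner_eq_Re_cinner: "inner x y = Re (cinner x y)"

instantiation complex :: chilbert_space
begin

definition scaleC_complex :: "complex \<Rightarrow> complex \<Rightarrow> complex" where
  "scaleC_complex a x = a * x"

definition cinner_complex :: "complex \<Rightarrow> complex \<Rightarrow> complex" where
  "cinner_complex x y = cnj x * y"

instance
  by standard
    (simp_all add: scaleC_complex_def cinner_complex_def inner_complex_def scaleR_conv_of_real
      algebra_simps)

end

text \<open>\<open>V\<close> is a closed complex subspace of Hilbert space dimension \<open>n\<close>, where \<open>n = \<infinity>\<close> stands for
  countably infinite dimension.\<close>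

definition has_hilbert_dim :: "'h::chilbert_space set \<Rightarrow> enat \<Rightarrow> bool" where
  "has_hilbert_dim V n \<longleftrightarrow>
     (\<exists>e :: nat \<Rightarrow> 'h.
        (\<forall>j k. enat j < n \<longrightarrow> enat k < n \<longrightarrow> cinner (e j) (e k) = (if j = k then 1 else 0)) \<and>
        V = closure (module.span scaleC (e ` {k. enat k < n})))"

definition bounded_clinear_between ::
  "'h::chilbert_space set \<Rightarrow> 'k::chilbert_space set \<Rightarrow> ('h \<Rightarrow> 'k) \<Rightarrow> bool" where
  "bounded_clinear_between V W A \<longleftrightarrow>
     (\<forall>v\<in>V. A v \<in> W) \<and>
     (\<forall>v\<in>V. \<forall>w\<in>V. A (v + w) = A v + A w) \<and>
     (\<forall>a. \<forall>v\<in>V. A (a *\<^sub>C v) = a *\<^sub>C A v) \<and>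
     (\<exists>C. \<forall>v\<in>V. norm (A v) \<le> C * norm v)"

definition unitary_between ::
  "'h::chilbert_space set \<Rightarrow> 'k::chilbert_space set \<Rightarrow> ('h \<Rightarrow> 'k) \<Rightarrow> bool" where
  "unitary_between V W A \<longleftrightarrow>
     bounded_clinear_between V W A \<and> A ` V = W \<and>
     (\<forall>v\<in>V. \<forall>w\<in>V. cinner (A v) (A w) = cinner v w)"

section \<open>Direct integrals\<close>

text \<open>A field of Hilbert spaces is a map from points to closed subspaces of an ambient separable
  Hilbert space, and its measurable sections are the Borel measurable maps with values in the
  fibres. Vectors of the direct integral are represented by square integrable sections; equality
  of vectors is equality almost everywhere.\<close>

definition sections :: "'x measure \<Rightarrow> ('x \<Rightarrow> 'h::chilbert_space set) \<Rightarrow> ('x \<Rightarrow> 'h) set" where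
  "sections M H = {\<xi> \<in> borel_measurable M. \<forall>x\<in>space M. \<xi> x \<in> H x}"

definition direct_integral ::
  "'x measure \<Rightarrow> ('x \<Rightarrow> 'h::chilbert_space set) \<Rightarrow> ('x \<Rightarrow> 'h) set" where
  "direct_integral M H = {\<xi> \<in> sections M H. integrable M (\<lambda>x. (norm (\<xi> x))\<^sup>2)}"

definition di_inner :: "'x measure \<Rightarrow> ('x \<Rightarrow> 'h::chilbert_space) \<Rightarrow> ('x \<Rightarrow> 'h) \<Rightarrow> complex" where
  "di_inner M \<xi> \<eta> = (LINT x|M. cinner (\<xi> x) (\<eta> x))"

definition di_norm :: "'x measure \<Rightarrow> ('x \<Rightarrow> 'h::chilbert_space) \<Rightarrow> real" where
  "di_norm M \<xi> = sqrt (LINT x|M. (norm (\<xi> x))\<^sup>2)"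

text \<open>A bounded operator between direct integrals acts on representatives. That it respects
  equality almost everywhere follows from linearity and the norm bound.\<close>

definition di_bounded_operator ::
  "'x measure \<Rightarrow> ('x \<Rightarrow> 'h::chilbert_space set) \<Rightarrow> 'y measure \<Rightarrow> ('y \<Rightarrow> 'k::chilbert_space set)
    \<Rightarrow> (('x \<Rightarrow> 'h) \<Rightarrow> ('y \<Rightarrow> 'k)) \<Rightarrow> bool" where
  "di_bounded_operator M H M' H' T \<longleftrightarrow>
     (\<forall>\<xi>\<in>direct_integral M H. T \<xi> \<in> direct_integral M' H') \<and>
     (\<forall>\<xi>\<in>direct_integral M H. \<forall>\<eta>\<in>direct_integral M H.
        AE y in M'. T (\<lambda>x. \<xi> x + \<eta> x) y = T \<xi> y + T \<eta> y) \<and>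
     (\<forall>a. \<forall>\<xi>\<in>direct_integral M H. AE y in M'. T (\<lambda>x. a *\<^sub>C \<xi> x) y = a *\<^sub>C T \<xi> y) \<and>
     (\<exists>C. \<forall>\<xi>\<in>direct_integral M H. di_norm M' (T \<xi>) \<le> C * di_norm M \<xi>)"

definition measurable_operator_field ::
  "'x measure \<Rightarrow> 'x set \<Rightarrow> ('x \<Rightarrow> 'h::chilbert_space set) \<Rightarrow> ('x \<Rightarrow> 'k::chilbert_space set)
    \<Rightarrow> ('x \<Rightarrow> 'h \<Rightarrow> 'k) \<Rightarrow> bool" where
  "measurable_operator_field M X H H' A \<longleftrightarrow>
     (\<forall>x\<in>X. bounded_clinear_between (H x) (H' x) (A x)) \<and>
     (\<forall>\<xi>\<in>sections M H. (\<lambda>x. A x (\<xi> x)) \<in> borel_measurable (restrict_space M X))"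

section \<open>Representations of the Cuntz algebra\<close>

text \<open>Unital representations of the Cuntz algebra on the direct integral correspond by
  universality to families satisfying \<open>S\<^sub>i\<^sup>* S\<^sub>j = \<delta>\<^sub>i\<^sub>j 1\<close> and \<open>\<Sum>\<^sub>i S\<^sub>i S\<^sub>i\<^sup>* = 1\<close>; the operators \<open>R i\<close> are
  the adjoints of the \<open>S i\<close>.\<close>

definition cuntz_representation ::
  "nat \<Rightarrow> 'x measure \<Rightarrow> ('x \<Rightarrow> 'h::chilbert_space set) \<Rightarrow> (nat \<Rightarrow> ('x \<Rightarrow> 'h) \<Rightarrow> ('x \<Rightarrow> 'h)) \<Rightarrow> bool"
  where
  "cuntz_representation d M H S \<longleftrightarrow>
     (\<exists>R. (\<forall>i\<in>{1..d}. di_bounded_operator M H M H (S i) \<and> di_bounded_operator M H M H (R i) \<and>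
             (\<forall>\<xi>\<in>direct_integral M H. \<forall>\<eta>\<in>direct_integral M H.
                di_inner M (S i \<xi>) \<eta> = di_inner M \<xi> (R i \<eta>))) \<and>
          (\<forall>i\<in>{1..d}. \<forall>j\<in>{1..d}. \<forall>\<xi>\<in>direct_integral M H.
             AE x in M. R i (S j \<xi>) x = (if i = j then \<xi> x else 0)) \<and>
          (\<forall>\<xi>\<in>direct_integral M H. AE x in M. (\<Sum>i=1..d. S i (R i \<xi>) x) = \<xi> x))"

section \<open>The one-sided shift\<close>

text \<open>Sequences are indexed from \<open>0\<close>, so the first letter of \<open>x\<close> is \<open>x 0\<close>. The Borel structure
  comes from the product topology on \<open>nat \<Rightarrow> nat\<close>.\<close>

definition Omega :: "nat \<Rightarrow> (nat \<Rightarrow> nat) set" where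
  "Omega d = {x. \<forall>k. x k \<in> {1..d}}"

definition Omega_borel :: "nat \<Rightarrow> (nat \<Rightarrow> nat) measure" where
  "Omega_borel d = restrict_space borel (Omega d)"

definition lshift :: "(nat \<Rightarrow> nat) \<Rightarrow> (nat \<Rightarrow> nat)" where
  "lshift x = (\<lambda>k. x (Suc k))"

definition prepend :: "nat \<Rightarrow> (nat \<Rightarrow> nat) \<Rightarrow> (nat \<Rightarrow> nat)" where
  "prepend i x = case_nat i x"

definition shift_quasi_invariant :: "(nat \<Rightarrow> nat) measure \<Rightarrow> bool" where
  "shift_quasi_invariant \<mu> \<longleftrightarrow>
     (\<forall>E\<in>sets \<mu>. emeasure \<mu> E = 0 \<longrightarrow> emeasure \<mu> (lshift -` E \<inter> space \<mu>) = 0)"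

definition prepend_quasi_invariant :: "nat \<Rightarrow> (nat \<Rightarrow> nat) measure \<Rightarrow> bool" where
  "prepend_quasi_invariant i \<mu> \<longleftrightarrow>
     (\<forall>E\<in>sets \<mu>. emeasure \<mu> E = 0 \<longrightarrow> emeasure \<mu> (prepend i -` E \<inter> space \<mu>) = 0)"

definition shift_invariant :: "nat \<Rightarrow> (nat \<Rightarrow> nat) set \<Rightarrow> bool" where
  "shift_invariant d E \<longleftrightarrow> lshift -` E \<inter> Omega d = E"

text \<open>On the sequences with first letter \<open>i\<close>, the measure \<open>distr \<mu> \<mu> (prepend i)\<close> is
  \<open>E \<mapsto> \<mu>(lshift ` E)\<close>; see \<open>emeasure_distr_prepend\<close> below.\<close>

definition rho :: "(nat \<Rightarrow> nat) measure \<Rightarrow> (nat \<Rightarrow> nat) \<Rightarrow> real" where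
  "rho \<mu> x = sqrt (enn2real (RN_deriv \<mu> (distr \<mu> \<mu> (prepend (x 0))) x))"

lemma space_Omega_borel: "space (Omega_borel d) = Omega d"
  by (simp add: Omega_borel_def space_restrict_space)

lemma measurable_prepend:
  assumes "i \<in> {1..d}"
  shows "prepend i \<in> measurable (Omega_borel d) (Omega_borel d)"
proof -
  have "continuous_on UNIV (prepend i)"
    unfolding prepend_def
  proof (rule continuous_on_coordinatewise_then_product)
    show "continuous_on UNIV (\<lambda>x. case_nat i x k)" for k
      by (cases k) (auto intro: continuous_on_product_coordinates)
  qed
  then have "prepend i \<in> borel_measurable borel"
    by (rule borel_measurable_continuous_onI)
  moreover have "prepend i x \<in> Omega d" if "x \<in> Omega d" for x
    using that assms by (auto simp: prepend_def Omega_def split: nat.split)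
  ultimately show ?thesis
    unfolding Omega_borel_def
    by (intro measurable_restrict_space3) auto
qed

lemma emeasure_distr_prepend:
  assumes "i \<in> {1..d}" and "sets \<mu> = sets (Omega_borel d)"
    and "E \<in> sets \<mu>" and "\<forall>x\<in>E. x 0 = i"
  shows "emeasure (distr \<mu> \<mu> (prepend i)) E = emeasure \<mu> (lshift ` E)"
proof -
  have sp: "space \<mu> = Omega d"
    using sets_eq_imp_space_eq[OF assms(2)] by (simp add: space_Omega_borel)
  have meas: "prepend i \<in> measurable \<mu> \<mu>"
    using measurable_prepend[OF assms(1)] assms(2) measurable_cong_sets by blast
  have E: "E \<subseteq> Omega d"
    using sets.sets_into_space[OF assms(3)] sp by simp
  have inv: "prepend i (lshift x) = x" if "x 0 = i" for x
    using that by (auto simp: prepend_def lshift_def fun_eq_iff split: nat.split)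
  have inv': "lshift (prepend i x) = x" for x
    by (auto simp: prepend_def lshift_def fun_eq_iff)
  have "prepend i -` E \<inter> space \<mu> = lshift ` E"
  proof (intro equalityI subsetI)
    fix x assume "x \<in> prepend i -` E \<inter> space \<mu>"
    then show "x \<in> lshift ` E" using inv'[of x] by (metis IntD1 imageI vimageD)
  next
    fix x assume "x \<in> lshift ` E"
    then obtain y where y: "y \<in> E" "x = lshift y" by blast
    then have "x \<in> Omega d" using E by (auto simp: Omega_def lshift_def)
    then show "x \<in> prepend i -` E \<inter> space \<mu>" using y inv assms(4) sp by auto
  qed
  then show ?thesis using emeasure_distr[OF meas assms(3)] by simp
qed

section \<open>Standard form\<close>

text \<open>\<open>N x\<close> is the dimension of the fibre at \<open>x\<close>, and \<open>K n\<close> is the fixed Hilbert space with which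
  all fibres of dimension \<open>n\<close> are identified.\<close>

definition fibre :: "(enat \<Rightarrow> 'h set) \<Rightarrow> ('x \<Rightarrow> enat) \<Rightarrow> 'x \<Rightarrow> 'h set" where
  "fibre K N x = K (N x)"

definition standard_form ::
  "nat \<Rightarrow> (nat \<Rightarrow> nat) measure \<Rightarrow> (enat \<Rightarrow> 'h::chilbert_space set) \<Rightarrow> ((nat \<Rightarrow> nat) \<Rightarrow> enat)
    \<Rightarrow> ((nat \<Rightarrow> nat) \<Rightarrow> 'h \<Rightarrow> 'h) \<Rightarrow> (nat \<Rightarrow> ((nat \<Rightarrow> nat) \<Rightarrow> 'h) \<Rightarrow> ((nat \<Rightarrow> nat) \<Rightarrow> 'h)) \<Rightarrow> bool"
  where
  "standard_form d \<mu> K N U S \<longleftrightarrow>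
     prob_space \<mu> \<and> sets \<mu> = sets (Omega_borel d) \<and>
     shift_quasi_invariant \<mu> \<and> (\<forall>i\<in>{1..d}. prepend_quasi_invariant i \<mu>) \<and>
     N \<in> measurable \<mu> (count_space UNIV) \<and>
     (\<forall>x\<in>Omega d. has_hilbert_dim (fibre K N x) (N x)) \<and>
     (AE x in \<mu>. N (lshift x) = N x) \<and>
     measurable_operator_field \<mu> (Omega d) (fibre K N) (fibre K N) U \<and>
     (\<forall>x\<in>Omega d. unitary_between (fibre K N x) (fibre K N x) (U x)) \<and>
     cuntz_representation d \<mu> (fibre K N) S \<and>
     (\<forall>i\<in>{1..d}. \<forall>\<xi>\<in>direct_integral \<mu> (fibre K N). AE x in \<mu>.
        S i \<xi> x = (if x 0 = i then rho \<mu> x *\<^sub>R U x (\<xi> (lshift x)) else 0))"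

section \<open>Intertwiners and decomposable operators\<close>

definition intertwiner ::
  "nat \<Rightarrow> 'x measure \<Rightarrow> ('x \<Rightarrow> 'h::chilbert_space set) \<Rightarrow> (nat \<Rightarrow> ('x \<Rightarrow> 'h) \<Rightarrow> ('x \<Rightarrow> 'h))
    \<Rightarrow> 'x measure \<Rightarrow> (nat \<Rightarrow> ('x \<Rightarrow> 'k::chilbert_space) \<Rightarrow> ('x \<Rightarrow> 'k))
    \<Rightarrow> (('x \<Rightarrow> 'h) \<Rightarrow> ('x \<Rightarrow> 'k)) \<Rightarrow> bool" where
  "intertwiner d \<mu> H S \<mu>' S' T \<longleftrightarrow>
     (\<forall>i\<in>{1..d}. \<forall>\<xi>\<in>direct_integral \<mu> H. AE x in \<mu>'. T (S i \<xi>) x = S' i (T \<xi>) x)"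

text \<open>The identification of the part of the direct integral over \<open>X\<close> with respect to \<open>\<mu>'\<close> with the
  one with respect to \<open>\<mu>\<close>: multiplication with the square root of the density of \<open>\<mu>'\<close>, restricted
  to \<open>X\<close>, with respect to \<open>\<mu>\<close>.\<close>

definition change_measure ::
  "'x measure \<Rightarrow> 'x measure \<Rightarrow> 'x set \<Rightarrow> ('x \<Rightarrow> 'k::chilbert_space) \<Rightarrow> ('x \<Rightarrow> 'k)" where
  "change_measure \<mu> \<mu>' X \<eta> x =
     sqrt (enn2real (RN_deriv \<mu> (density \<mu>' (indicator X)) x)) *\<^sub>R \<eta> x"

definition decomposes_over ::
  "'x measure \<Rightarrow> ('x \<Rightarrow> 'h::chilbert_space set) \<Rightarrow> 'x measure \<Rightarrow> 'x set
    \<Rightarrow> (('x \<Rightarrow> 'h) \<Rightarrow> ('x \<Rightarrow> 'k::chilbert_space)) \<Rightarrow> ('x \<Rightarrow> 'h \<Rightarrow> 'k) \<Rightarrow> bool" where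
  "decomposes_over \<mu> H \<mu>' X T A \<longleftrightarrow>
     (\<forall>\<xi>\<in>direct_integral \<mu> H. (AE x in \<mu>. x \<in> X \<longrightarrow> \<xi> x = 0) \<longrightarrow> (AE x in \<mu>'. T \<xi> x = 0)) \<and>
     (\<forall>\<xi>\<in>direct_integral \<mu> H. AE x in \<mu>'. x \<notin> X \<longrightarrow> T \<xi> x = 0) \<and>
     (\<forall>\<xi>\<in>direct_integral \<mu> H. AE x in \<mu>. x \<in> X \<longrightarrow> change_measure \<mu> \<mu>' X (T \<xi>) x = A x (\<xi> x))"

end

theory Submission
  imports Defs
begin

text \<open>Since \<open>S\<^sub>i S\<^sub>i\<^sup>*\<close> is multiplication by the indicator of the sequences with first letter \<open>i\<close>, an
  intertwiner commutes with multiplication by indicators of cylinder sets, hence of all Borel sets.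
  It is therefore local, and with \<open>g = (d\<mu>'/d\<mu>)\<^sup>1\<^sup>/\<^sup>2\<close> on \<open>\<Omega>0\<close> the norm bound localises to
  \<open>\<bar>g T\<xi>\<bar> \<le> C \<bar>\<xi>\<bar>\<close> almost everywhere. Applied to countably many sections that are dense in the
  fibres, this bound yields the operators \<open>A x\<close>. The covariance relation is equivalent to the
  intertwining relation by the cocycle identity \<open>\<rho>(x) g(\<sigma> x) = g(x) \<rho>'(x)\<close> and
  \<open>\<rho> > 0\<close>.\<close>

section \<open>Closed subspaces and extension of operators\<close>

\<comment> \<open>The relation \<open>T S_i = S'_i T\<close> says nothing about adjoints, so
  commutation with the range projections is not immediate. It comes from the relation that the range
  projections sum to 1: \<open>T\<close> maps the range of \<open>S_j\<close> into that of
  \<open>S'_j\<close>, and on either side these ranges consist of sections with disjoint supports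
  that exhaust the space, so components can be compared letter by letter.

  The recurring obstacle is the exceptional set. Vectors are representatives, and each identity for
  \<open>T\<close> holds off a null set that depends on the vectors, whereas a fibre operator needs
  one null set for all vectors of a fibre. Hence dense sequences, countable coefficient sets and
  bounds that survive limits. Two further transports of null sets are needed: covariance compares
  \<open>x\<close> with \<open>lshift x\<close>, which quasi-invariance under the shift permits, and
  facts about \<open>T\<close> and \<open>S'\<close> hold for the second measure while the
  decomposition refers to the first, which is harmless on \<Omega>0 because the null sets agree
  there.\<close>
subclass (in chilbert_space) banach ..

lemma scaleC_one [simp]: "1 *\<^sub>C (x::'a::chilbert_space) = x"
  using scaleR_eq_scaleC[of 1 x] by simp

lemma norm_scaleC: "norm (a *\<^sub>C (x::'a::chilbert_space)) = norm a * norm x"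
proof -
  have cl: "cinner (b *\<^sub>C y) z = cnj b * cinner y z" for b and y z :: 'a
    by (metis cinner_commute cinner_scaleC_right complex_cnj_mult)
  have "cinner x x = cnj (cinner x x)"
    by (rule cinner_commute)
  then have re: "cinner x x = complex_of_real ((norm x)\<^sup>2)"
    by (simp add: complex_eq_iff power2_norm_eq_inner inner_eq_Re_cinner)
  have "(norm (a *\<^sub>C x))\<^sup>2 = Re (cnj a * a * complex_of_real ((norm x)\<^sup>2))"
    by (simp add: power2_norm_eq_inner[of "a *\<^sub>C x"] inner_eq_Re_cinner cl cinner_scaleC_right re mult_ac)
  also have "cnj a * a = complex_of_real ((norm a)\<^sup>2)"
    using complex_norm_square[of a] by (simp add: mult.commute)
  finally have "(norm (a *\<^sub>C x))\<^sup>2 = (norm a * norm x)\<^sup>2"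
    by (simp add: power_mult_distrib flip: of_real_mult)
  then show ?thesis
    by (simp add: power2_eq_iff_nonneg)
qed

interpretation scaleC: bounded_bilinear "scaleC :: complex \<Rightarrow> 'a::chilbert_space \<Rightarrow> 'a"
proof
  fix a b :: complex and x y :: 'a and r :: real
  show "(a + b) *\<^sub>C x = a *\<^sub>C x + b *\<^sub>C x" by (rule scaleC_add_left)
  show "a *\<^sub>C (x + y) = a *\<^sub>C x + a *\<^sub>C y" by (rule scaleC_add_right)
  show "(r *\<^sub>R a) *\<^sub>C x = r *\<^sub>R (a *\<^sub>C x)"
    by (simp add: scaleR_eq_scaleC[of r "a *\<^sub>C x"] scaleC_scaleC scaleR_conv_of_real)
  show "a *\<^sub>C (r *\<^sub>R x) = r *\<^sub>R (a *\<^sub>C x)"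
    by (simp add: scaleR_eq_scaleC scaleC_scaleC mult.commute)
  show "\<exists>K. \<forall>(a::complex) (x::'a). norm (a *\<^sub>C x) \<le> norm a * norm x * K"
    by (intro exI[of _ 1]) (simp add: norm_scaleC)
qed

interpretation scaleC: module "scaleC :: complex \<Rightarrow> 'a::chilbert_space \<Rightarrow> 'a"
  by standard (simp_all add: scaleC_add_left scaleC_add_right scaleC_scaleC)

definition closed_csubspace :: "'a::chilbert_space set \<Rightarrow> bool" where
  "closed_csubspace V \<longleftrightarrow> closed V \<and> module.subspace scaleC V"

lemma closed_csubspaceD:
  assumes "closed_csubspace V"
  shows "closed V" "0 \<in> V" "v \<in> V \<Longrightarrow> w \<in> V \<Longrightarrow> v + w \<in> V" "v \<in> V \<Longrightarrow> a *\<^sub>C v \<in> V"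
    "v \<in> V \<Longrightarrow> r *\<^sub>R v \<in> V"
  using assms
  by (auto simp: closed_csubspace_def scaleC.subspace_def scaleR_eq_scaleC)

lemma has_hilbert_dim_closed_csubspace:
  assumes "has_hilbert_dim V n"
  shows "closed_csubspace V"
proof -
  obtain B where V: "V = closure (module.span scaleC B)"
    using assms by (auto simp: has_hilbert_dim_def)
  let ?L = "module.span scaleC B"
  have "v + w \<in> V" if v: "v \<in> V" and w: "w \<in> V" for v w
  proof -
    obtain f where "\<And>n. f n \<in> ?L" "f \<longlonglongrightarrow> v"
      using v unfolding V closure_sequential by blast
    moreover obtain g where "\<And>n. g n \<in> ?L" "g \<longlonglongrightarrow> w"
      using w unfolding V closure_sequential by blast
    ultimately show ?thesis
      unfolding V closure_sequential
      by (intro exI[of _ "\<lambda>n. f n + g n"]) (auto intro: tendsto_add scaleC.span_add)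
  qed
  moreover have "a *\<^sub>C v \<in> V" if v: "v \<in> V" for a v
  proof -
    obtain f where "\<And>n. f n \<in> ?L" "f \<longlonglongrightarrow> v"
      using v unfolding V closure_sequential by blast
    then show ?thesis
      unfolding V closure_sequential
      by (intro exI[of _ "\<lambda>n. a *\<^sub>C f n"]) (auto intro: scaleC.tendsto scaleC.span_scale)
  qed
  moreover have "0 \<in> V"
    unfolding V using scaleC.span_zero closure_subset by blast
  ultimately show ?thesis
    by (auto simp: closed_csubspace_def scaleC.subspace_def V)
qed

lemma measurable_scaleC [measurable (raw)]:
  fixes f :: "'x \<Rightarrow> 'a::{chilbert_space, second_countable_topology}"
  assumes "a \<in> borel_measurable M" "f \<in> borel_measurable M"
  shows "(\<lambda>x. a x *\<^sub>C f x) \<in> borel_measurable M"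
  using assms by (rule borel_measurable_continuous_Pair)
    (intro scaleC.continuous_on continuous_intros)

lemma bounded_clinear_betweenD:
  assumes "bounded_clinear_between V W A"
  shows "v \<in> V \<Longrightarrow> A v \<in> W" "v \<in> V \<Longrightarrow> w \<in> V \<Longrightarrow> A (v + w) = A v + A w"
    "v \<in> V \<Longrightarrow> A (a *\<^sub>C v) = a *\<^sub>C A v" "v \<in> V \<Longrightarrow> A (r *\<^sub>R v) = r *\<^sub>R A v"
    "closed_csubspace V \<Longrightarrow> A 0 = 0"
proof -
  show sc: "v \<in> V \<Longrightarrow> A (a *\<^sub>C v) = a *\<^sub>C A v" for a v
    using assms by (auto simp: bounded_clinear_between_def)
  show "closed_csubspace V \<Longrightarrow> A 0 = 0"
    using sc[of 0 0] by (simp add: closed_csubspaceD scaleC.zero_left)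
qed (use assms in \<open>auto simp: bounded_clinear_between_def scaleR_eq_scaleC\<close>)

text \<open>\<open>A\<close> is constrained on \<open>V\<close> alone, so the difference is formed
  inside \<open>V\<close>, as \<open>f n + (-1) *\<^sub>C v\<close>, before linearity and the norm
  bound are applied to it.\<close>

lemma bounded_clinear_between_tendsto:
  assumes A: "bounded_clinear_between V W A" and V: "closed_csubspace V"
    and f: "\<And>n. f n \<in> V" "v \<in> V" "f \<longlonglongrightarrow> v"
  shows "(\<lambda>n. A (f n)) \<longlonglongrightarrow> A v"
proof -
  obtain C where C: "\<And>v. v \<in> V \<Longrightarrow> norm (A v) \<le> C * norm v"
    using A unfolding bounded_clinear_between_def by blast
  have "A (f n + (-1) *\<^sub>C v) = A (f n) + (-1) *\<^sub>C A v" for n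
    using f closed_csubspaceD[OF V]
    by (simp only: bounded_clinear_betweenD(2,3)[OF A])
  then have le: "norm (A (f n) - A v) \<le> C * norm (f n - v)" for n
    using C[OF closed_csubspaceD(3)[OF V f(1) closed_csubspaceD(4)[OF V f(2)]], of n "-1"]
    by (simp add: scaleC.minus_left)
  have "(\<lambda>n. f n - v) \<longlonglongrightarrow> 0"
    using f(3) by (simp add: LIM_zero_iff)
  then have "(\<lambda>n. C * norm (f n - v)) \<longlonglongrightarrow> 0"
    by (intro tendsto_mult_right_zero tendsto_norm_zero)
  then have "(\<lambda>n. A (f n) - A v) \<longlonglongrightarrow> 0"
    by (rule Lim_null_comparison[rotated]) (simp add: le)
  then show ?thesis
    by (simp add: LIM_zero_iff)
qed

text \<open>With \<open>y j\<close> prescribed as the value at \<open>D j\<close>, the bound on combinations of three points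
  contains both linearity and continuity of the extension.\<close>

definition dense_extension :: "(nat \<Rightarrow> 'a::metric_space) \<Rightarrow> (nat \<Rightarrow> 'b::t2_space) \<Rightarrow> 'a \<Rightarrow> 'b" where
  "dense_extension D y v = lim (\<lambda>m. y (LEAST j. dist (D j) v < inverse (real (Suc m))))"

lemma dense_extension:
  fixes D :: "nat \<Rightarrow> 'h::chilbert_space" and y :: "nat \<Rightarrow> 'k::chilbert_space"
  assumes V: "closed_csubspace V" and W: "closed_csubspace W"
    and D: "V \<subseteq> closure (range D)" and y: "\<And>j. y j \<in> W" and "0 \<le> C"
    and bound: "\<And>a b c i j k. norm (a *\<^sub>C y i + b *\<^sub>C y j + c *\<^sub>C y k) \<le> C * norm (a *\<^sub>C D i + b *\<^sub>C D j + c *\<^sub>C D k)"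
  shows "bounded_clinear_between V W (dense_extension D y)"
    and "\<And>v w. v \<in> V \<Longrightarrow> (\<And>j. norm (w - y j) \<le> C * norm (v - D j)) \<Longrightarrow> dense_extension D y v = w"
proof -
  define J where "J v m = (LEAST j. dist (D j) v < inverse (real (Suc m)))" for v m
  have A: "dense_extension D y v = lim (\<lambda>m. y (J v m))" for v
    by (simp add: dense_extension_def J_def)
  have J: "dist (D (J v m)) v < inverse (real (Suc m))" if "v \<in> V" for v m
  proof -
    have "\<exists>j. dist (D j) v < inverse (real (Suc m))"
      using D that closure_approachable[of v "range D"] inverse_positive_iff_positive of_nat_0_less_iff
      by (metis in_mono rangeE zero_less_Suc)
    then show ?thesis
      unfolding J_def by (rule LeastI_ex)
  qed
  have DJ: "(\<lambda>m. D (J v m)) \<longlonglongrightarrow> v" if "v \<in> V" for v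
    by (rule metric_tendsto_imp_tendsto[OF LIMSEQ_inverse_real_of_nat])
      (use J[OF that] in \<open>auto intro!: always_eventually less_imp_le simp del: of_nat_Suc\<close>)
  have lip: "norm (y i - y j) \<le> C * norm (D i - D j)" for i j
    using bound[of 1 i "-1" j 0] by (simp add: scaleC.minus_left scaleC.zero_left)
  have conv: "(\<lambda>m. y (J v m)) \<longlonglongrightarrow> dense_extension D y v" if v: "v \<in> V" for v
  proof -
    have "Cauchy (\<lambda>m. D (J v m))"
      using DJ[OF v] by (rule LIMSEQ_imp_Cauchy)
    have "Cauchy (\<lambda>m. y (J v m))"
    proof (rule metric_CauchyI)
      fix e :: real assume "0 < e"
      \<comment> \<open>Dividing by \<open>C + 1\<close> rather than \<open>C\<close> covers the
        case \<open>C = 0\<close>.\<close>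
      then have "0 < e / (C + 1)" using \<open>0 \<le> C\<close> by simp
      then obtain n0 where n0: "\<And>m n. m \<ge> n0 \<Longrightarrow> n \<ge> n0 \<Longrightarrow> dist (D (J v m)) (D (J v n)) < e / (C + 1)"
        using \<open>Cauchy (\<lambda>m. D (J v m))\<close> by (meson Cauchy_def)
      have "dist (y (J v m)) (y (J v n)) < e" if "m \<ge> n0" "n \<ge> n0" for m n
      proof -
        have "dist (y (J v m)) (y (J v n)) \<le> C * dist (D (J v m)) (D (J v n))"
          using lip by (simp add: dist_norm)
        also have "\<dots> \<le> C * (e / (C + 1))"
          using n0[OF that] \<open>0 \<le> C\<close> by (intro mult_left_mono) auto
        also have "\<dots> < e"
          using \<open>0 < e\<close> \<open>0 \<le> C\<close> by (simp add: field_simps)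
        finally show ?thesis .
      qed
      then show "\<exists>M. \<forall>m\<ge>M. \<forall>n\<ge>M. dist (y (J v m)) (y (J v n)) < e"
        by blast
    qed
    then show ?thesis
      unfolding A by (simp add: Cauchy_convergent_iff convergent_LIMSEQ_iff)
  qed
  let ?A = "dense_extension D y"
  \<comment> \<open>The three-term bound passes to the limit. Each linearity law is then an instance
    whose right-hand side is the norm of 0, for example coefficients 1, 1, -1 at \<open>v\<close>,
    \<open>w\<close>, \<open>v + w\<close>.\<close>
  have lim_bound: "norm (a *\<^sub>C ?A u + b *\<^sub>C ?A v + c *\<^sub>C ?A w) \<le> C * norm (a *\<^sub>C u + b *\<^sub>C v + c *\<^sub>C w)"
    if "u \<in> V" "v \<in> V" "w \<in> V" for a b c u v w
  proof (rule LIMSEQ_le)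
    show "(\<lambda>m. norm (a *\<^sub>C y (J u m) + b *\<^sub>C y (J v m) + c *\<^sub>C y (J w m)))
        \<longlonglongrightarrow> norm (a *\<^sub>C ?A u + b *\<^sub>C ?A v + c *\<^sub>C ?A w)"
      by (intro tendsto_norm tendsto_add scaleC.tendsto tendsto_const conv that)
    show "(\<lambda>m. C * norm (a *\<^sub>C D (J u m) + b *\<^sub>C D (J v m) + c *\<^sub>C D (J w m)))
        \<longlonglongrightarrow> C * norm (a *\<^sub>C u + b *\<^sub>C v + c *\<^sub>C w)"
      by (intro tendsto_mult tendsto_norm tendsto_add scaleC.tendsto tendsto_const DJ that)
  qed (use bound in auto)
  show "bounded_clinear_between V W ?A"
    unfolding bounded_clinear_between_def
  proof (intro conjI ballI allI exI)
    fix v assume v: "v \<in> V"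
    show "?A v \<in> W"
      using closed_sequentially[OF closed_csubspaceD(1)[OF W] _ conv[OF v]] y by blast
    show "norm (?A v) \<le> C * norm v"
      using lim_bound[OF v v v, of 1 0 0] by (simp add: scaleC.zero_left)
    show "?A (a *\<^sub>C v) = a *\<^sub>C ?A v" for a
      using lim_bound[OF v closed_csubspaceD(4)[OF V v, of a] v, of a "-1" 0]
      by (simp add: scaleC.zero_left scaleC.minus_left)
    fix w assume w: "w \<in> V"
    show "?A (v + w) = ?A v + ?A w"
      using lim_bound[OF v w closed_csubspaceD(3)[OF V v w], of 1 1 "-1"]
      by (simp add: scaleC.minus_left)
  qed
  fix v w assume v: "v \<in> V" and w: "\<And>j. norm (w - y j) \<le> C * norm (v - D j)"
  \<comment> \<open>The right-hand side is zero, written as the limit of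
    \<open>norm (v - D j)\<close> along the indices \<open>J v m\<close>.\<close>
  have "norm (w - ?A v) \<le> C * norm (v - v)"
  proof (rule LIMSEQ_le)
    show "(\<lambda>m. norm (w - y (J v m))) \<longlonglongrightarrow> norm (w - ?A v)"
      by (intro tendsto_norm tendsto_diff tendsto_const conv v)
    show "(\<lambda>m. C * norm (v - D (J v m))) \<longlonglongrightarrow> C * norm (v - v)"
      by (intro tendsto_mult tendsto_norm tendsto_diff tendsto_const DJ v)
  qed (use w in auto)
  then show "?A v = w" by simp
qed

section \<open>Operators between direct integrals\<close>

lemma direct_integralD:
  assumes "\<xi> \<in> direct_integral M H"
  shows "\<xi> \<in> borel_measurable M" "x \<in> space M \<Longrightarrow> \<xi> x \<in> H x" "integrable M (\<lambda>x. (norm (\<xi> x))\<^sup>2)"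
    "(\<integral>\<^sup>+x. ennreal ((norm (\<xi> x))\<^sup>2) \<partial>M) = ennreal ((di_norm M \<xi>)\<^sup>2)"
  using assms
  by (auto simp: direct_integral_def sections_def di_norm_def nn_integral_eq_integral)

lemma direct_integral_bounded:
  fixes \<xi> :: "'x \<Rightarrow> 'h::{chilbert_space, second_countable_topology}"
  assumes "\<eta> \<in> borel_measurable M" "\<And>x. x \<in> space M \<Longrightarrow> \<eta> x \<in> H x"
    and "integrable M g" "\<And>x. x \<in> space M \<Longrightarrow> (norm (\<eta> x))\<^sup>2 \<le> g x"
  shows "\<eta> \<in> direct_integral M H"
proof -
  have "integrable M (\<lambda>x. (norm (\<eta> x))\<^sup>2)"
    by (rule Bochner_Integration.integrable_bound[OF assms(3)])
      (use assms in \<open>auto intro!: AE_I2 order_trans[OF _ abs_ge_self]\<close>)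
  then show ?thesis
    using assms by (simp add: direct_integral_def sections_def)
qed

context
  fixes M :: "'x measure" and H :: "'x \<Rightarrow> 'h::{chilbert_space, second_countable_topology} set"
  assumes H: "\<And>x. x \<in> space M \<Longrightarrow> closed_csubspace (H x)"
begin

lemma direct_integral_zero: "(\<lambda>x. 0) \<in> direct_integral M H"
  by (auto simp: direct_integral_def sections_def intro: closed_csubspaceD(2)[OF H])

lemma direct_integral_scaleC:
  assumes "\<xi> \<in> direct_integral M H"
  shows "(\<lambda>x. a *\<^sub>C \<xi> x) \<in> direct_integral M H"
  using direct_integralD(1-3)[OF assms]
  by (auto simp: direct_integral_def sections_def norm_scaleC power_mult_distrib
      intro: closed_csubspaceD(4)[OF H])

lemma direct_integral_add:
  assumes \<xi>: "\<xi> \<in> direct_integral M H" and \<eta>: "\<eta> \<in> direct_integral M H"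
  shows "(\<lambda>x. \<xi> x + \<eta> x) \<in> direct_integral M H"
proof (rule direct_integral_bounded)
  note [measurable] = direct_integralD(1)[OF \<xi>] direct_integralD(1)[OF \<eta>]
  show "(\<lambda>x. \<xi> x + \<eta> x) \<in> borel_measurable M"
    by measurable
  show "\<xi> x + \<eta> x \<in> H x" if "x \<in> space M" for x
    by (intro closed_csubspaceD(3)[OF H] direct_integralD(2)[OF \<xi>] direct_integralD(2)[OF \<eta>] that)
  show "integrable M (\<lambda>x. 2 * (norm (\<xi> x))\<^sup>2 + 2 * (norm (\<eta> x))\<^sup>2)"
    using direct_integralD(3)[OF \<xi>] direct_integralD(3)[OF \<eta>] by simp
  show "(norm (\<xi> x + \<eta> x))\<^sup>2 \<le> 2 * (norm (\<xi> x))\<^sup>2 + 2 * (norm (\<eta> x))\<^sup>2" for x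
  proof -
    have "(norm (\<xi> x + \<eta> x))\<^sup>2 \<le> (norm (\<xi> x) + norm (\<eta> x))\<^sup>2"
      by (intro power_mono norm_triangle_ineq) simp
    also have "\<dots> \<le> 2 * (norm (\<xi> x))\<^sup>2 + 2 * (norm (\<eta> x))\<^sup>2"
      using sum_squares_bound[of "norm (\<xi> x)" "norm (\<eta> x)"] by (simp add: power2_sum)
    finally show ?thesis .
  qed
qed

lemma direct_integral_indicator:
  assumes \<xi>: "\<xi> \<in> direct_integral M H" and [measurable]: "E \<in> sets M"
  shows "(\<lambda>x. indicator E x *\<^sub>R \<xi> x) \<in> direct_integral M H"
proof (rule direct_integral_bounded)
  note [measurable] = direct_integralD(1)[OF \<xi>]
  show "(\<lambda>x. indicator E x *\<^sub>R \<xi> x) \<in> borel_measurable M"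
    by measurable
  show "indicator E x *\<^sub>R \<xi> x \<in> H x" if "x \<in> space M" for x
    by (intro closed_csubspaceD(5)[OF H] direct_integralD(2)[OF \<xi>] that)
  show "integrable M (\<lambda>x. (norm (\<xi> x))\<^sup>2)"
    by (rule direct_integralD(3)[OF \<xi>])
  show "(norm (indicator E x *\<^sub>R \<xi> x))\<^sup>2 \<le> (norm (\<xi> x))\<^sup>2" for x
    by (simp add: indicator_def)
qed

lemma direct_integral_sum:
  assumes "finite I" "\<And>i. i \<in> I \<Longrightarrow> \<xi> i \<in> direct_integral M H"
  shows "(\<lambda>x. \<Sum>i\<in>I. \<xi> i x) \<in> direct_integral M H"
  using assms by (induction I) (auto intro: direct_integral_zero direct_integral_add)

end

text \<open>On the set where \<open>w < u\<close> the hypothesis would contradict strict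
  monotonicity of the integral. Strictness requires the smaller integral to be finite, hence
  \<open>fin\<close>.\<close>

lemma nn_integral_le_imp_AE_le:
  assumes [measurable]: "u \<in> borel_measurable M" "w \<in> borel_measurable M"
    and fin: "(\<integral>\<^sup>+x. w x \<partial>M) \<noteq> \<infinity>"
    and le: "\<And>E. E \<in> sets M \<Longrightarrow> (\<integral>\<^sup>+x. u x * indicator E x \<partial>M) \<le> (\<integral>\<^sup>+x. w x * indicator E x \<partial>M)"
  shows "AE x in M. u x \<le> (w x :: ennreal)"
proof (rule ccontr)
  define E where "E = {x \<in> space M. w x < u x}"
  have E [measurable]: "E \<in> sets M"
    by (simp add: E_def)
  assume not_le: "\<not> ?thesis"
  have "(\<integral>\<^sup>+x. w x * indicator E x \<partial>M) < (\<integral>\<^sup>+x. u x * indicator E x \<partial>M)"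
  proof (rule nn_integral_less)
    have "(\<integral>\<^sup>+x. w x * indicator E x \<partial>M) \<le> (\<integral>\<^sup>+x. w x \<partial>M)"
      by (intro nn_integral_mono) (simp add: indicator_def)
    then show "(\<integral>\<^sup>+x. w x * indicator E x \<partial>M) \<noteq> \<infinity>"
      using fin by (auto simp: top_unique)
    show "AE x in M. w x * indicator E x \<le> u x * indicator E x"
      by (intro AE_I2) (auto simp: E_def indicator_def)
    show "\<not> (AE x in M. u x * indicator E x \<le> w x * indicator E x)"
    proof
      assume "AE x in M. u x * indicator E x \<le> w x * indicator E x"
      then have "AE x in M. u x \<le> w x"
        using AE_space by eventually_elim (auto simp: E_def indicator_def not_less intro: leI)
      then show False
        using not_le by simp
    qed
  qed measurable
  then show False
    using le[OF E] by simp
qed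

section \<open>Bounded operators acting on representatives\<close>

locale direct_integral_operator =
  fixes M M' :: "'x measure"
    and H :: "'x \<Rightarrow> 'h::{chilbert_space, second_countable_topology} set"
    and H' :: "'x \<Rightarrow> 'k::{chilbert_space, second_countable_topology} set"
    and T :: "('x \<Rightarrow> 'h) \<Rightarrow> ('x \<Rightarrow> 'k)"
  assumes sets_eq [measurable_cong]: "sets M' = sets M"
    and H: "\<And>x. x \<in> space M \<Longrightarrow> closed_csubspace (H x)"
    and H': "\<And>x. x \<in> space M \<Longrightarrow> closed_csubspace (H' x)"
    and op: "di_bounded_operator M H M' H' T"
begin

lemma space_eq: "space M' = space M"
  using sets_eq by (rule sets_eq_imp_space_eq)

lemma range_T: "\<xi> \<in> direct_integral M H \<Longrightarrow> T \<xi> \<in> direct_integral M' H'"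
  using op by (simp add: di_bounded_operator_def)

lemma T_add:
  "\<xi> \<in> direct_integral M H \<Longrightarrow> \<eta> \<in> direct_integral M H \<Longrightarrow> AE x in M'. T (\<lambda>x. \<xi> x + \<eta> x) x = T \<xi> x + T \<eta> x"
  using op by (simp add: di_bounded_operator_def)

lemma T_scaleC:
  "\<xi> \<in> direct_integral M H \<Longrightarrow> AE x in M'. T (\<lambda>x. a *\<^sub>C \<xi> x) x = a *\<^sub>C T \<xi> x"
  using op by (simp add: di_bounded_operator_def)

lemma T_nn_bound:
  obtains C where "0 \<le> C"
    "\<And>\<xi>. \<xi> \<in> direct_integral M H \<Longrightarrow>
      (\<integral>\<^sup>+x. ennreal ((norm (T \<xi> x))\<^sup>2) \<partial>M') \<le> ennreal (C\<^sup>2) * (\<integral>\<^sup>+x. ennreal ((norm (\<xi> x))\<^sup>2) \<partial>M)"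
proof -
  obtain C where C: "\<And>\<xi>. \<xi> \<in> direct_integral M H \<Longrightarrow> di_norm M' (T \<xi>) \<le> C * di_norm M \<xi>"
    using op unfolding di_bounded_operator_def by blast
  show ?thesis
  \<comment> \<open>The given constant may be negative if every vector has norm zero; the absolute
    value makes squaring the bound legitimate.\<close>
  proof (rule that[of "\<bar>C\<bar>"])
    fix \<xi> assume \<xi>: "\<xi> \<in> direct_integral M H"
    have "di_norm M' (T \<xi>) \<le> \<bar>C\<bar> * di_norm M \<xi>"
      using C[OF \<xi>] by (rule order_trans) (auto simp: di_norm_def intro!: mult_right_mono)
    then have "(di_norm M' (T \<xi>))\<^sup>2 \<le> (\<bar>C\<bar> * di_norm M \<xi>)\<^sup>2"
      by (intro power_mono) (auto simp: di_norm_def)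
    then show "(\<integral>\<^sup>+x. ennreal ((norm (T \<xi> x))\<^sup>2) \<partial>M')
        \<le> ennreal (\<bar>C\<bar>\<^sup>2) * (\<integral>\<^sup>+x. ennreal ((norm (\<xi> x))\<^sup>2) \<partial>M)"
      by (simp add: direct_integralD(4)[OF \<xi>] direct_integralD(4)[OF range_T[OF \<xi>]] power_mult_distrib
          flip: ennreal_mult)
  qed simp
qed

lemma T_eq_zero:
  assumes \<xi>: "\<xi> \<in> direct_integral M H" and "AE x in M. \<xi> x = 0"
  shows "AE x in M'. T \<xi> x = 0"
proof -
  obtain C where C: "(\<integral>\<^sup>+x. ennreal ((norm (T \<xi> x))\<^sup>2) \<partial>M') \<le> ennreal (C\<^sup>2) * (\<integral>\<^sup>+x. ennreal ((norm (\<xi> x))\<^sup>2) \<partial>M)"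
    using T_nn_bound \<xi> by metis
  note [measurable] = direct_integralD(1)[OF range_T[OF \<xi>]]
  have "(\<integral>\<^sup>+x. ennreal ((norm (\<xi> x))\<^sup>2) \<partial>M) = (\<integral>\<^sup>+x. 0 \<partial>M)"
    using assms(2) by (intro nn_integral_cong_AE) auto
  then have "(\<integral>\<^sup>+x. ennreal ((norm (T \<xi> x))\<^sup>2) \<partial>M') = 0"
    using C by simp
  then show ?thesis
    by (subst (asm) nn_integral_0_iff_AE) (auto simp: ennreal_eq_0_iff)
qed

lemma T_cong_AE:
  assumes \<xi>: "\<xi> \<in> direct_integral M H" and \<eta>: "\<eta> \<in> direct_integral M H" and "AE x in M. \<xi> x = \<eta> x"
  shows "AE x in M'. T \<xi> x = T \<eta> x"
proof -
  \<comment> \<open>Additivity and homogeneity are assumed for sums and complex multiples, so the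
    difference is written with the scalar -1.\<close>
  have m: "(\<lambda>x. (-1) *\<^sub>C \<eta> x) \<in> direct_integral M H"
    by (rule direct_integral_scaleC[OF H \<eta>])
  have "AE x in M'. T (\<lambda>x. \<xi> x + (-1) *\<^sub>C \<eta> x) x = 0"
    using assms(3) by (intro T_eq_zero direct_integral_add[OF H] \<xi> m) (auto simp: scaleC.minus_left)
  then show ?thesis
    using T_add[OF \<xi> m] T_scaleC[OF \<eta>, of "-1"]
    by eventually_elim (simp add: scaleC.minus_left)
qed

lemma T_sum:
  assumes "finite I" "\<And>i. i \<in> I \<Longrightarrow> \<xi> i \<in> direct_integral M H"
  shows "AE x in M'. T (\<lambda>x. \<Sum>i\<in>I. \<xi> i x) x = (\<Sum>i\<in>I. T (\<xi> i) x)"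
  using assms
proof (induction I)
  case empty
  show ?case using T_eq_zero[OF direct_integral_zero[OF H]] by simp
next
  case (insert i I)
  have "(\<lambda>x. \<Sum>i\<in>I. \<xi> i x) \<in> direct_integral M H"
    using insert by (intro direct_integral_sum[OF H]) auto
  then have "AE x in M'. T (\<lambda>x. \<xi> i x + (\<Sum>i\<in>I. \<xi> i x)) x = T (\<xi> i) x + T (\<lambda>x. \<Sum>i\<in>I. \<xi> i x) x"
    using insert by (intro T_add) auto
  moreover have "AE x in M'. T (\<lambda>x. \<Sum>i\<in>I. \<xi> i x) x = (\<Sum>i\<in>I. T (\<xi> i) x)"
    using insert by auto
  ultimately show ?case
    by eventually_elim (simp add: insert.hyps)
qed

section \<open>The sigma-algebra of sets whose indicator multiplications commute with the
  operator\<close>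

definition commuting_sets :: "'x set set" where
  "commuting_sets = {E \<in> sets M. \<forall>\<xi>\<in>direct_integral M H.
     AE x in M'. T (\<lambda>y. indicator E y *\<^sub>R \<xi> y) x = indicator E x *\<^sub>R T \<xi> x}"

lemma commuting_setsD:
  "E \<in> commuting_sets \<Longrightarrow> E \<in> sets M"
  "E \<in> commuting_sets \<Longrightarrow> \<xi> \<in> direct_integral M H \<Longrightarrow>
    AE x in M'. T (\<lambda>y. indicator E y *\<^sub>R \<xi> y) x = indicator E x *\<^sub>R T \<xi> x"
  by (auto simp: commuting_sets_def)

text \<open>This is continuity from above of the measure with density
  \<open>(norm (\<xi> x))\<^sup>2\<close>, which is finite by square integrability. It serves both a
  vector and its image, hence the separate measure and fibres.\<close>

lemma nn_integral_decreasing_sets: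
  fixes \<xi> :: "'x \<Rightarrow> 'c::{chilbert_space, second_countable_topology}"
  assumes \<xi>: "\<xi> \<in> direct_integral N L" and F: "\<And>n. F n \<in> sets N" "decseq F" "(\<Inter>n. F n) = {}"
  shows "(\<lambda>n. \<integral>\<^sup>+x. ennreal ((norm (indicator (F n) x *\<^sub>R \<xi> x))\<^sup>2) \<partial>N) \<longlonglongrightarrow> 0"
proof -
  note [measurable] = F(1) direct_integralD(1)[OF \<xi>]
  define \<nu> where "\<nu> = density N (\<lambda>x. ennreal ((norm (\<xi> x))\<^sup>2))"
  have em: "emeasure \<nu> E = (\<integral>\<^sup>+x. ennreal ((norm (indicator E x *\<^sub>R \<xi> x))\<^sup>2) \<partial>N)"
    if [measurable]: "E \<in> sets N" for E
    unfolding \<nu>_def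
    by (subst emeasure_density) (auto intro!: nn_integral_cong simp: indicator_def)
  have "emeasure \<nu> (F n) \<noteq> \<infinity>" for n
  proof -
    have "emeasure \<nu> (F n) \<le> (\<integral>\<^sup>+x. ennreal ((norm (\<xi> x))\<^sup>2) \<partial>N)"
      unfolding em[OF F(1)] by (intro nn_integral_mono) (simp add: indicator_def)
    then show ?thesis
      unfolding direct_integralD(4)[OF \<xi>] by (auto simp: top_unique)
  qed
  then have "(\<lambda>n. emeasure \<nu> (F n)) \<longlonglongrightarrow> emeasure \<nu> (\<Inter>n. F n)"
    using F by (intro Lim_emeasure_decseq) (auto simp: \<nu>_def)
  then show ?thesis
    using F by (simp add: em)
qed

text \<open>Complements come from additivity applied to the splitting of a vector over
  \<open>E\<close> and its complement. Intersections come from composing two multiplications, the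
  one for \<open>E\<close> being applied to the vector already cut to \<open>F\<close>.\<close>

lemma algebra_commuting_sets: "algebra (space M) commuting_sets"
  unfolding algebra_iff_Int
proof (intro conjI ballI)
  show "commuting_sets \<subseteq> Pow (space M)"
    using sets.sets_into_space by (auto simp: commuting_sets_def)
  show "{} \<in> commuting_sets"
    using T_eq_zero[OF direct_integral_zero[OF H]] by (simp add: commuting_sets_def)
  fix E assume E: "E \<in> commuting_sets"
  note [measurable] = commuting_setsD(1)[OF E]
  show "space M - E \<in> commuting_sets"
    unfolding commuting_sets_def
  proof (intro CollectI conjI ballI)
    fix \<xi> assume \<xi>: "\<xi> \<in> direct_integral M H"
    have a: "(\<lambda>x. indicator (space M - E) x *\<^sub>R \<xi> x) \<in> direct_integral M H"
      "(\<lambda>x. indicator E x *\<^sub>R \<xi> x) \<in> direct_integral M H"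
      by (intro direct_integral_indicator[OF H] \<xi>; measurable)+
    have "AE x in M'. T (\<lambda>x. indicator (space M - E) x *\<^sub>R \<xi> x + indicator E x *\<^sub>R \<xi> x) x = T \<xi> x"
      by (intro T_cong_AE direct_integral_add[OF H] a \<xi>) (auto simp: indicator_def intro!: AE_I2)
    with T_add[OF a] commuting_setsD(2)[OF E \<xi>] AE_space
    show "AE x in M'. T (\<lambda>y. indicator (space M - E) y *\<^sub>R \<xi> y) x = indicator (space M - E) x *\<^sub>R T \<xi> x"
      by eventually_elim (auto simp: indicator_def space_eq split: if_splits)
  qed measurable
next
  fix E F assume E: "E \<in> commuting_sets" and F: "F \<in> commuting_sets"
  note [measurable] = commuting_setsD(1)[OF E] commuting_setsD(1)[OF F]
  show "E \<inter> F \<in> commuting_sets"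
    unfolding commuting_sets_def
  proof (intro CollectI conjI ballI)
    fix \<xi> assume \<xi>: "\<xi> \<in> direct_integral M H"
    have "(\<lambda>x. indicator F x *\<^sub>R \<xi> x) \<in> direct_integral M H"
      by (intro direct_integral_indicator[OF H] \<xi>) measurable
    from commuting_setsD(2)[OF E this] commuting_setsD(2)[OF F \<xi>]
    show "AE x in M'. T (\<lambda>y. indicator (E \<inter> F) y *\<^sub>R \<xi> y) x = indicator (E \<inter> F) x *\<^sub>R T \<xi> x"
      by eventually_elim (simp add: indicator_inter_arith)
  qed measurable
qed

text \<open>The finite unions \<open>G n\<close> commute, so the defect \<open>?D\<close> of the
  full union equals the defect of the tail \<open>F n\<close> for every \<open>n\<close>. By
  boundedness of \<open>T\<close>, both terms of the latter tend to zero in norm, while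
  \<open>?D\<close> does not depend on \<open>n\<close>.\<close>

lemma sigma_algebra_commuting_sets: "sigma_algebra (space M) commuting_sets"
  unfolding sigma_algebra_iff
proof (intro conjI allI impI algebra_commuting_sets)
  interpret algebra "space M" commuting_sets
    by (rule algebra_commuting_sets)
  fix A :: "nat \<Rightarrow> 'x set" assume A: "range A \<subseteq> commuting_sets"
  define G where "G n = (\<Union>k<n. A k)" for n
  define F where "F n = (\<Union>k. A k) - G n" for n
  have A_sets [measurable]: "A k \<in> sets M" for k
    using A commuting_setsD(1) by blast
  have [measurable]: "G n \<in> sets M" "F n \<in> sets M" "(\<Union>k. A k) \<in> sets M" for n
    by (auto simp: G_def F_def)
  have F: "decseq F" "(\<Inter>n. F n) = {}"
    by (force simp: F_def G_def decseq_def)+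
  obtain C where C: "\<And>\<xi>. \<xi> \<in> direct_integral M H \<Longrightarrow>
      (\<integral>\<^sup>+x. ennreal ((norm (T \<xi> x))\<^sup>2) \<partial>M') \<le> ennreal (C\<^sup>2) * (\<integral>\<^sup>+x. ennreal ((norm (\<xi> x))\<^sup>2) \<partial>M)"
    using T_nn_bound by blast
  show "(\<Union>k. A k) \<in> commuting_sets"
    unfolding commuting_sets_def
  proof (intro CollectI conjI ballI)
    fix \<xi> assume \<xi>: "\<xi> \<in> direct_integral M H"
    note T\<xi> = range_T[OF \<xi>]
    let ?D = "\<lambda>x. T (\<lambda>y. indicator (\<Union>k. A k) y *\<^sub>R \<xi> y) x - indicator (\<Union>k. A k) x *\<^sub>R T \<xi> x"
    have ind: "(\<lambda>x. indicator E x *\<^sub>R \<xi> x) \<in> direct_integral M H" if "E \<in> sets M" for E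
      by (intro direct_integral_indicator[OF H] \<xi> that)
    have TF: "T (\<lambda>x. indicator (F n) x *\<^sub>R \<xi> x) \<in> direct_integral M' H'" for n
      by (intro range_T ind) measurable
    note [measurable] = direct_integralD(1)[OF T\<xi>] direct_integralD(1)[OF TF]
      direct_integralD(1)[OF range_T[OF ind]]
    define a where "a n = (\<integral>\<^sup>+x. ennreal ((norm (indicator (F n) x *\<^sub>R \<xi> x))\<^sup>2) \<partial>M)" for n
    define b where "b n = (\<integral>\<^sup>+x. ennreal ((norm (indicator (F n) x *\<^sub>R T \<xi> x))\<^sup>2) \<partial>M')" for n
    have le: "(\<integral>\<^sup>+x. ennreal ((norm (?D x))\<^sup>2) \<partial>M') \<le> 2 * (ennreal (C\<^sup>2) * a n) + 2 * b n" for n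
    proof -
      have G: "AE x in M'. T (\<lambda>y. indicator (G n) y *\<^sub>R \<xi> y) x = indicator (G n) x *\<^sub>R T \<xi> x"
        unfolding G_def using A \<xi> by (intro commuting_setsD(2) finite_UN) auto
      have "AE x in M'. T (\<lambda>x. indicator (G n) x *\<^sub>R \<xi> x + indicator (F n) x *\<^sub>R \<xi> x) x
          = T (\<lambda>x. indicator (\<Union>k. A k) x *\<^sub>R \<xi> x) x"
        by (intro T_cong_AE direct_integral_add[OF H] ind)
          (auto simp: indicator_def F_def G_def intro!: AE_I2)
      moreover have "AE x in M'. T (\<lambda>x. indicator (G n) x *\<^sub>R \<xi> x + indicator (F n) x *\<^sub>R \<xi> x) x
          = T (\<lambda>x. indicator (G n) x *\<^sub>R \<xi> x) x + T (\<lambda>x. indicator (F n) x *\<^sub>R \<xi> x) x"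
        by (intro T_add ind) measurable
      ultimately have D: "AE x in M'. ?D x = T (\<lambda>x. indicator (F n) x *\<^sub>R \<xi> x) x - indicator (F n) x *\<^sub>R T \<xi> x"
        using G by eventually_elim (auto simp: indicator_def F_def G_def split: if_splits)
      \<comment> \<open>This pointwise inequality stands in for the triangle inequality of the
        square integral norm, at the cost of factors 2.\<close>
      have sq: "(norm (u - v))\<^sup>2 \<le> 2 * (norm u)\<^sup>2 + 2 * (norm v)\<^sup>2" for u v :: 'k
      proof -
        have "(norm (u - v))\<^sup>2 \<le> (norm u + norm v)\<^sup>2"
          by (intro power_mono norm_triangle_ineq4) simp
        also have "\<dots> \<le> 2 * (norm u)\<^sup>2 + 2 * (norm v)\<^sup>2"
          using sum_squares_bound[of "norm u" "norm v"] by (simp add: power2_sum)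
        finally show ?thesis .
      qed
      have "(\<integral>\<^sup>+x. ennreal ((norm (?D x))\<^sup>2) \<partial>M')
          \<le> (\<integral>\<^sup>+x. 2 * ennreal ((norm (T (\<lambda>x. indicator (F n) x *\<^sub>R \<xi> x) x))\<^sup>2)
                + 2 * ennreal ((norm (indicator (F n) x *\<^sub>R T \<xi> x))\<^sup>2) \<partial>M')"
      proof (rule nn_integral_mono_AE, use D in eventually_elim)
        fix x assume D: "?D x = T (\<lambda>x. indicator (F n) x *\<^sub>R \<xi> x) x - indicator (F n) x *\<^sub>R T \<xi> x"
        show "ennreal ((norm (?D x))\<^sup>2) \<le> 2 * ennreal ((norm (T (\<lambda>x. indicator (F n) x *\<^sub>R \<xi> x) x))\<^sup>2)
                + 2 * ennreal ((norm (indicator (F n) x *\<^sub>R T \<xi> x))\<^sup>2)"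
          unfolding D
          using ennreal_leI[OF sq[of "T (\<lambda>x. indicator (F n) x *\<^sub>R \<xi> x) x" "indicator (F n) x *\<^sub>R T \<xi> x"]]
          by (simp add: ennreal_mult flip: ennreal_numeral)
      qed
      also have "\<dots> = 2 * (\<integral>\<^sup>+x. ennreal ((norm (T (\<lambda>x. indicator (F n) x *\<^sub>R \<xi> x) x))\<^sup>2) \<partial>M') + 2 * b n"
        unfolding b_def by (subst nn_integral_add) (auto simp: nn_integral_cmult)
      also have "\<dots> \<le> 2 * (ennreal (C\<^sup>2) * a n) + 2 * b n"
        unfolding a_def by (intro add_right_mono mult_left_mono C ind) auto
      finally show ?thesis .
    qed
    have ab: "a \<longlonglongrightarrow> 0" "b \<longlonglongrightarrow> 0"
      unfolding a_def b_def
      by (rule nn_integral_decreasing_sets[OF \<xi>] nn_integral_decreasing_sets[OF T\<xi>];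
          use F in \<open>simp add: sets_eq\<close>)+
    have "(\<lambda>n. 2 * (ennreal (C\<^sup>2) * a n) + 2 * b n) \<longlonglongrightarrow> 2 * (ennreal (C\<^sup>2) * 0) + 2 * 0"
      by (intro tendsto_add ennreal_tendsto_cmult ab) auto
    then have "(\<integral>\<^sup>+x. ennreal ((norm (?D x))\<^sup>2) \<partial>M') \<le> 0"
      by (intro LIMSEQ_le_const[where X = "\<lambda>n. 2 * (ennreal (C\<^sup>2) * a n) + 2 * b n"]) (auto simp: le)
    then have "AE x in M'. ennreal ((norm (?D x))\<^sup>2) = 0"
      by (subst (asm) le_zero_eq, subst (asm) nn_integral_0_iff_AE) auto
    then show "AE x in M'. T (\<lambda>y. indicator (\<Union>k. A k) y *\<^sub>R \<xi> y) x = indicator (\<Union>k. A k) x *\<^sub>R T \<xi> x"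
      by eventually_elim (simp add: ennreal_eq_0_iff)
  qed measurable
qed

end

section \<open>Decomposition of local operators\<close>

text \<open>Locality lets the norm bound be tested on \<open>E\<close>: applied to the vector cut to
  \<open>E\<close>, it compares the integrals of both squared norms over \<open>E\<close>. As
  \<open>E\<close> is arbitrary, the integrands compare almost everywhere. The density
  \<open>G\<close> moves the left integral from \<open>M'\<close> to \<open>M\<close>.\<close>

lemma (in direct_integral_operator) T_pointwise_bound:
  assumes comm: "sets M \<subseteq> commuting_sets" and [measurable]: "X \<in> sets M" "G \<in> borel_measurable M"
    and G: "density M G = density M' (indicator X)"
  obtains C where "0 \<le> C"
    "\<And>\<xi>. \<xi> \<in> direct_integral M H \<Longrightarrow> AE x in M. norm (sqrt (enn2real (G x)) *\<^sub>R T \<xi> x) \<le> C * norm (\<xi> x)"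
proof -
  obtain C where C: "0 \<le> C" "\<And>\<xi>. \<xi> \<in> direct_integral M H \<Longrightarrow>
      (\<integral>\<^sup>+x. ennreal ((norm (T \<xi> x))\<^sup>2) \<partial>M') \<le> ennreal (C\<^sup>2) * (\<integral>\<^sup>+x. ennreal ((norm (\<xi> x))\<^sup>2) \<partial>M)"
    using T_nn_bound by blast
  have "AE x in M. norm (sqrt (enn2real (G x)) *\<^sub>R T \<xi> x) \<le> C * norm (\<xi> x)"
    if \<xi>: "\<xi> \<in> direct_integral M H" for \<xi>
  proof -
    have [measurable]: "T \<xi> \<in> borel_measurable M"
      using direct_integralD(1)[OF range_T[OF \<xi>]] by measurable
    note [measurable] = direct_integralD(1)[OF \<xi>]
    have "AE x in M. G x * ennreal ((norm (T \<xi> x))\<^sup>2) \<le> ennreal (C\<^sup>2) * ennreal ((norm (\<xi> x))\<^sup>2)"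
    proof (rule nn_integral_le_imp_AE_le)
      show "(\<integral>\<^sup>+x. ennreal (C\<^sup>2) * ennreal ((norm (\<xi> x))\<^sup>2) \<partial>M) \<noteq> \<infinity>"
        by (simp add: nn_integral_cmult direct_integralD(4)[OF \<xi>] ennreal_mult_eq_top_iff)
      fix E assume E [measurable]: "E \<in> sets M"
      let ?\<xi> = "\<lambda>x. indicator E x *\<^sub>R \<xi> x"
      have \<xi>E: "?\<xi> \<in> direct_integral M H"
        by (rule direct_integral_indicator[OF H \<xi> E])
      have "(\<integral>\<^sup>+x. G x * ennreal ((norm (T \<xi> x))\<^sup>2) * indicator E x \<partial>M)
          = (\<integral>\<^sup>+x. ennreal ((norm (T \<xi> x))\<^sup>2) * indicator E x \<partial>density M G)"
        by (subst nn_integral_density) (auto simp: mult_ac)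
      also have "\<dots> = (\<integral>\<^sup>+x. indicator X x * (ennreal ((norm (T \<xi> x))\<^sup>2) * indicator E x) \<partial>M')"
        unfolding G by (subst nn_integral_density) auto
      \<comment> \<open>Commutation with \<open>E\<close> turns \<open>T \<xi>\<close> cut to
        \<open>E\<close> into \<open>T ?\<xi>\<close>; forgetting the indicator of \<open>X\<close>
        only enlarges the integral.\<close>
      also have "\<dots> \<le> (\<integral>\<^sup>+x. ennreal ((norm (T ?\<xi> x))\<^sup>2) \<partial>M')"
      proof (rule nn_integral_mono_AE)
        have "E \<in> commuting_sets"
          using comm E by blast
        from commuting_setsD(2)[OF this \<xi>]
        show "AE x in M'. indicator X x * (ennreal ((norm (T \<xi> x))\<^sup>2) * indicator E x)
            \<le> ennreal ((norm (T ?\<xi> x))\<^sup>2)"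
          by eventually_elim (auto simp: indicator_def)
      qed
      also have "\<dots> \<le> ennreal (C\<^sup>2) * (\<integral>\<^sup>+x. ennreal ((norm (?\<xi> x))\<^sup>2) \<partial>M)"
        by (rule C(2)[OF \<xi>E])
      also have "\<dots> = (\<integral>\<^sup>+x. ennreal (C\<^sup>2) * ennreal ((norm (\<xi> x))\<^sup>2) * indicator E x \<partial>M)"
        by (subst nn_integral_cmult[symmetric]) (auto intro!: nn_integral_cong simp: indicator_def)
      finally show "(\<integral>\<^sup>+x. G x * ennreal ((norm (T \<xi> x))\<^sup>2) * indicator E x \<partial>M)
          \<le> (\<integral>\<^sup>+x. ennreal (C\<^sup>2) * ennreal ((norm (\<xi> x))\<^sup>2) * indicator E x \<partial>M)" .
    qed measurable
    then show ?thesis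
    proof eventually_elim
      fix x assume le: "G x * ennreal ((norm (T \<xi> x))\<^sup>2) \<le> ennreal (C\<^sup>2) * ennreal ((norm (\<xi> x))\<^sup>2)"
      have "enn2real (G x) * (norm (T \<xi> x))\<^sup>2 = enn2real (G x * ennreal ((norm (T \<xi> x))\<^sup>2))"
        by (simp add: enn2real_mult)
      also have "\<dots> \<le> C\<^sup>2 * (norm (\<xi> x))\<^sup>2"
        using le by (intro enn2real_leI) (auto simp: ennreal_mult)
      finally have "(norm (sqrt (enn2real (G x)) *\<^sub>R T \<xi> x))\<^sup>2 \<le> (C * norm (\<xi> x))\<^sup>2"
        by (simp add: power_mult_distrib)
      then show "norm (sqrt (enn2real (G x)) *\<^sub>R T \<xi> x) \<le> C * norm (\<xi> x)"
        by (rule power2_le_imp_le) (simp add: C(1))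
    qed
  qed
  with C(1) show ?thesis by (rule that)
qed

lemma dense_sequence:
  fixes V :: "'a::{metric_space, second_countable_topology} set"
  assumes "V \<noteq> {}"
  obtains D :: "nat \<Rightarrow> 'a" where "range D \<subseteq> V" "V \<subseteq> closure (range D)"
proof -
  obtain Q where Q: "countable Q" "Q \<subseteq> V" "V \<subseteq> closure Q"
    by (rule separable)
  then have "Q \<noteq> {}"
    using assms by auto
  then show ?thesis
    using Q that[of "from_nat_into Q"] by simp
qed

text \<open>An almost everywhere statement can be intersected only over countably many coefficients.
  Both sides are continuous in the coefficients, so a dense sequence of them suffices.\<close>

lemma scaleC_combination_bound:
  fixes y1 y2 y3 :: "'k::chilbert_space" and d1 d2 d3 :: "'h::chilbert_space"
  assumes Q: "closure (range q) = (UNIV :: complex set)"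
    and le: "\<And>i j k. norm (q i *\<^sub>C y1 + q j *\<^sub>C y2 + q k *\<^sub>C y3) \<le> C * norm (q i *\<^sub>C d1 + q j *\<^sub>C d2 + q k *\<^sub>C d3)"
  shows "norm (a *\<^sub>C y1 + b *\<^sub>C y2 + c *\<^sub>C y3) \<le> C * norm (a *\<^sub>C d1 + b *\<^sub>C d2 + c *\<^sub>C d3)"
proof -
  have ex: "\<exists>f :: nat \<Rightarrow> _. (\<lambda>n. q (f n)) \<longlonglongrightarrow> z" for z
  proof -
    have "z \<in> closure (range q)"
      using Q by simp
    then obtain g where g: "\<And>n. g n \<in> range q" "g \<longlonglongrightarrow> z"
      unfolding closure_sequential by blast
    from g(1) have "\<forall>n. \<exists>k. g n = q k"
      by blast
    from choice[OF this] obtain f where "\<forall>n. g n = q (f n)"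
      by blast
    then have "g = (\<lambda>n. q (f n))"
      by auto
    with g(2) have "(\<lambda>n. q (f n)) \<longlonglongrightarrow> z"
      by simp
    then show ?thesis
      by blast
  qed
  obtain f g h where lim: "(\<lambda>n. q (f n)) \<longlonglongrightarrow> a" "(\<lambda>n. q (g n)) \<longlonglongrightarrow> b" "(\<lambda>n. q (h n)) \<longlonglongrightarrow> c"
    using ex by metis
  show ?thesis
  proof (rule LIMSEQ_le)
    show "(\<lambda>n. norm (q (f n) *\<^sub>C y1 + q (g n) *\<^sub>C y2 + q (h n) *\<^sub>C y3))
        \<longlonglongrightarrow> norm (a *\<^sub>C y1 + b *\<^sub>C y2 + c *\<^sub>C y3)"
      by (intro tendsto_norm tendsto_add scaleC.tendsto tendsto_const lim)
    show "(\<lambda>n. C * norm (q (f n) *\<^sub>C d1 + q (g n) *\<^sub>C d2 + q (h n) *\<^sub>C d3))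
        \<longlonglongrightarrow> C * norm (a *\<^sub>C d1 + b *\<^sub>C d2 + c *\<^sub>C d3)"
      by (intro tendsto_mult tendsto_norm tendsto_add scaleC.tendsto tendsto_const lim)
  qed (use le in auto)
qed

text \<open>Fibres depend on \<open>x\<close> through \<open>N x\<close> only, so one dense sequence
  per dimension gives sections that are constant on \<open>{x. N x = n}\<close> and 0 elsewhere.
  They are square integrable because the measure is finite, and there are countably many because
  dimensions are.\<close>

lemma dense_sections:
  fixes M :: "'x measure" and K :: "enat \<Rightarrow> 'h::{chilbert_space, second_countable_topology} set"
  assumes fin: "finite_measure M" and N [measurable]: "N \<in> measurable M (count_space UNIV)"
    and H: "\<forall>x\<in>space M. closed_csubspace (fibre K N x)"
  obtains D :: "enat \<Rightarrow> nat \<Rightarrow> 'h" where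
    "\<forall>n j. (\<lambda>x. if N x = n then D n j else 0) \<in> direct_integral M (fibre K N)"
    "\<forall>x\<in>space M. \<forall>j. D (N x) j \<in> fibre K N x"
    "\<forall>x\<in>space M. fibre K N x \<subseteq> closure (range (D (N x)))"
proof -
  interpret finite_measure M by fact
  \<comment> \<open>\<open>K n\<close> is under control only for dimensions that occur; for the
    others it may even be empty.\<close>
  have "\<exists>D :: nat \<Rightarrow> 'h. range D \<subseteq> K n \<and> K n \<subseteq> closure (range D)" if "n \<in> N ` space M" for n
  proof -
    obtain x where "x \<in> space M" "n = N x"
      using \<open>n \<in> N ` space M\<close> by (rule imageE)
    then have "K n \<noteq> {}"
      using closed_csubspaceD(2)[OF H[rule_format, of x]] by (auto simp: fibre_def)
    then obtain D :: "nat \<Rightarrow> 'h" where "range D \<subseteq> K n" "K n \<subseteq> closure (range D)"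
      by (rule dense_sequence)
    then show ?thesis
      by blast
  qed
  then have "\<forall>n. \<exists>D :: nat \<Rightarrow> 'h. n \<in> N ` space M \<longrightarrow> range D \<subseteq> K n \<and> K n \<subseteq> closure (range D)"
    by blast
  from choice[OF this] obtain D :: "enat \<Rightarrow> nat \<Rightarrow> 'h"
    where D: "\<forall>n. n \<in> N ` space M \<longrightarrow> range (D n) \<subseteq> K n \<and> K n \<subseteq> closure (range (D n))"
    by blast
  have D_in: "D (N x) j \<in> fibre K N x"
    and D_dense: "fibre K N x \<subseteq> closure (range (D (N x)))" if "x \<in> space M" for x j
    using D[rule_format, OF imageI[OF that, of N]] unfolding fibre_def by blast+
  have "(\<lambda>x. if N x = n then D n j else 0) \<in> direct_integral M (fibre K N)" for n j
  proof (rule direct_integral_bounded)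
    show "(\<lambda>x. if N x = n then D n j else 0) \<in> borel_measurable M"
      by measurable
    show "(if N x = n then D n j else 0) \<in> fibre K N x" if "x \<in> space M" for x
      using D_in[OF that] closed_csubspaceD(2)[OF H[rule_format, OF that]] by auto
    show "integrable M (\<lambda>x. (norm (D n j))\<^sup>2)"
      by simp
    show "(norm (if N x = n then D n j else 0))\<^sup>2 \<le> (norm (D n j))\<^sup>2" for x
      by simp
  qed
  with D_in D_dense show ?thesis
    by (intro that[of D]) blast+
qed

text \<open>The fibre operator at \<open>x\<close> is prescribed on the dense sequence \<open>D (N x)\<close> of the fibre. Since
  there are only countably many fibres, all sections \<open>\<delta> n j\<close> and all combinations with
  coefficients in a countable dense set share one exceptional null set.\<close>

lemma decomposable_if_pointwise_bounded:
  fixes M :: "'x measure" and K :: "enat \<Rightarrow> 'h::{chilbert_space, second_countable_topology} set"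
    and H' :: "'x \<Rightarrow> 'k::{chilbert_space, second_countable_topology} set"
    and N :: "'x \<Rightarrow> enat" and \<Phi> :: "('x \<Rightarrow> 'h) \<Rightarrow> 'x \<Rightarrow> 'k"
  defines "\<H> \<equiv> direct_integral M (fibre K N)"
  assumes fin: "finite_measure M" and N [measurable]: "N \<in> measurable M (count_space UNIV)"
    and H: "\<And>x. x \<in> space M \<Longrightarrow> closed_csubspace (fibre K N x)"
    and H': "\<And>x. x \<in> space M \<Longrightarrow> closed_csubspace (H' x)"
    and \<Phi>_sections: "\<And>\<xi>. \<xi> \<in> \<H> \<Longrightarrow> \<Phi> \<xi> \<in> sections M H'"
    and \<Phi>_add: "\<And>\<xi> \<eta>. \<xi> \<in> \<H> \<Longrightarrow> \<eta> \<in> \<H> \<Longrightarrow> AE x in M. \<Phi> (\<lambda>x. \<xi> x + \<eta> x) x = \<Phi> \<xi> x + \<Phi> \<eta> x"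
    and \<Phi>_scaleC: "\<And>a \<xi>. \<xi> \<in> \<H> \<Longrightarrow> AE x in M. \<Phi> (\<lambda>x. a *\<^sub>C \<xi> x) x = a *\<^sub>C \<Phi> \<xi> x"
    and "0 \<le> C" and \<Phi>_bound: "\<And>\<xi>. \<xi> \<in> \<H> \<Longrightarrow> AE x in M. norm (\<Phi> \<xi> x) \<le> C * norm (\<xi> x)"
  obtains A where "measurable_operator_field M (space M) (fibre K N) H' A"
    "\<And>\<xi>. \<xi> \<in> \<H> \<Longrightarrow> AE x in M. \<Phi> \<xi> x = A x (\<xi> x)"
proof -
  have add: "(\<lambda>x. \<xi> x + \<eta> x) \<in> \<H>" if "\<xi> \<in> \<H>" "\<eta> \<in> \<H>" for \<xi> \<eta>
    using that unfolding \<H>_def by (intro direct_integral_add H)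
  have scaleC: "(\<lambda>x. a *\<^sub>C \<xi> x) \<in> \<H>" if "\<xi> \<in> \<H>" for a \<xi>
    using that unfolding \<H>_def by (intro direct_integral_scaleC H)
  have \<Phi>_meas: "\<Phi> \<xi> \<in> borel_measurable M" and \<Phi>_H': "x \<in> space M \<Longrightarrow> \<Phi> \<xi> x \<in> H' x"
    if "\<xi> \<in> \<H>" for \<xi> x
    using \<Phi>_sections[OF that] by (auto simp: sections_def)
  \<comment> \<open>The three-term form feeds the linearity part of \<open>dense_extension\<close>;
    the two-term form later compares a general section with those of the dense family.\<close>
  have \<Phi>_bound2: "AE x in M. norm (a *\<^sub>C \<Phi> \<xi> x + b *\<^sub>C \<Phi> \<eta> x) \<le> C * norm (a *\<^sub>C \<xi> x + b *\<^sub>C \<eta> x)"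
    and \<Phi>_bound3: "AE x in M. norm (a *\<^sub>C \<Phi> \<xi> x + b *\<^sub>C \<Phi> \<eta> x + c *\<^sub>C \<Phi> \<zeta> x)
        \<le> C * norm (a *\<^sub>C \<xi> x + b *\<^sub>C \<eta> x + c *\<^sub>C \<zeta> x)"
    if "\<xi> \<in> \<H>" "\<eta> \<in> \<H>" "\<zeta> \<in> \<H>" for a b c \<xi> \<eta> \<zeta>
  proof -
    have 2: "AE x in M. \<Phi> (\<lambda>x. a *\<^sub>C \<xi> x + b *\<^sub>C \<eta> x) x = a *\<^sub>C \<Phi> \<xi> x + b *\<^sub>C \<Phi> \<eta> x"
      using \<Phi>_add[OF scaleC[OF that(1), of a] scaleC[OF that(2), of b]] \<Phi>_scaleC[OF that(1), of a]
        \<Phi>_scaleC[OF that(2), of b]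
      by eventually_elim simp
    have in2: "(\<lambda>x. a *\<^sub>C \<xi> x + b *\<^sub>C \<eta> x) \<in> \<H>"
      by (intro add scaleC that)
    show "AE x in M. norm (a *\<^sub>C \<Phi> \<xi> x + b *\<^sub>C \<Phi> \<eta> x) \<le> C * norm (a *\<^sub>C \<xi> x + b *\<^sub>C \<eta> x)"
      using \<Phi>_bound[OF in2] 2 by eventually_elim simp
    show "AE x in M. norm (a *\<^sub>C \<Phi> \<xi> x + b *\<^sub>C \<Phi> \<eta> x + c *\<^sub>C \<Phi> \<zeta> x)
        \<le> C * norm (a *\<^sub>C \<xi> x + b *\<^sub>C \<eta> x + c *\<^sub>C \<zeta> x)"
      using \<Phi>_bound[OF add[OF in2 scaleC[OF that(3), of c]]] 2 \<Phi>_scaleC[OF that(3), of c]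
        \<Phi>_add[OF in2 scaleC[OF that(3), of c]]
      by eventually_elim simp
  qed
  have "\<forall>x\<in>space M. closed_csubspace (fibre K N x)"
    using H by blast
  then obtain D :: "enat \<Rightarrow> nat \<Rightarrow> 'h" where
    D_\<H>: "\<forall>n j. (\<lambda>x. if N x = n then D n j else 0) \<in> direct_integral M (fibre K N)"
    and D_dense: "\<forall>x\<in>space M. fibre K N x \<subseteq> closure (range (D (N x)))"
    by (rule dense_sections[OF fin N])
  obtain q :: "nat \<Rightarrow> complex" where "UNIV \<subseteq> closure (range q)"
    by (rule dense_sequence[OF UNIV_not_empty])
  then have q: "closure (range q) = UNIV"
    by auto
  define \<delta> where "\<delta> n j x = (if N x = n then D n j else 0)" for n j x
  have \<delta>: "\<delta> n j \<in> \<H>" for n j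
    using D_\<H> by (simp add: \<H>_def \<delta>_def[abs_def])
  note [measurable] = \<Phi>_meas[OF \<delta>]
  define good where "good x \<longleftrightarrow> (\<forall>n i j k l m p. norm (q l *\<^sub>C \<Phi> (\<delta> n i) x + q m *\<^sub>C \<Phi> (\<delta> n j) x + q p *\<^sub>C \<Phi> (\<delta> n k) x)
      \<le> C * norm (q l *\<^sub>C \<delta> n i x + q m *\<^sub>C \<delta> n j x + q p *\<^sub>C \<delta> n k x))" for x
  have "AE x in M. good x"
    unfolding good_def AE_all_countable by (intro allI \<Phi>_bound3 \<delta>)
  then obtain Z where Z: "Z \<in> null_sets M" and good: "\<And>x. x \<in> space M - Z \<Longrightarrow> good x"
    by (rule AE_E3) blast
  have [measurable]: "Z \<in> sets M"
    using Z by auto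
  define y where "y x j = \<Phi> (\<delta> (N x) j) x" for x j
  \<comment> \<open>The value 0 on the exceptional set makes \<open>A x\<close> a bounded linear map
    at every point, not just almost everywhere.\<close>
  define A where "A x v = (if x \<in> Z then 0 else dense_extension (D (N x)) (y x) v)" for x v
  have y_meas [measurable]: "(\<lambda>x. y x j) \<in> borel_measurable M" for j
    unfolding y_def by (rule measurable_compose_countable[OF _ N]) measurable
  have bound: "norm (a *\<^sub>C y x i + b *\<^sub>C y x j + c *\<^sub>C y x k)
      \<le> C * norm (a *\<^sub>C D (N x) i + b *\<^sub>C D (N x) j + c *\<^sub>C D (N x) k)"
    if "x \<in> space M" "x \<notin> Z" for a b c x i j k
    by (rule scaleC_combination_bound[OF q])
      (use good[of x] that in \<open>auto simp: good_def y_def \<delta>_def dest: spec[of _ "N x"]\<close>)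
  have y_H': "y x j \<in> H' x" if "x \<in> space M" for x j
    unfolding y_def by (rule \<Phi>_H'[OF \<delta> that])
  note ext = dense_extension[OF H H' bspec[OF D_dense] y_H' \<open>0 \<le> C\<close> bound]
  show ?thesis
  proof (rule that)
    show "measurable_operator_field M (space M) (fibre K N) H' A"
      unfolding measurable_operator_field_def
    proof (intro conjI ballI)
      fix x assume x: "x \<in> space M"
      show "bounded_clinear_between (fibre K N x) (H' x) (A x)"
      proof (cases "x \<in> Z")
        case True
        then show ?thesis
          using closed_csubspaceD(2)[OF H'[OF x]]
          by (auto simp: A_def bounded_clinear_between_def scaleC.zero_right intro!: exI[of _ 0])
      next
        case False
        with ext(1)[OF x x x x x False] show ?thesis
          by (simp add: A_def[abs_def])
      qed
    next
      fix \<xi> assume "\<xi> \<in> sections M (fibre K N)"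
      then have [measurable]: "\<xi> \<in> borel_measurable M"
        by (simp add: sections_def)
      have [measurable]: "(\<lambda>x. D (N x) j) \<in> borel_measurable M" for j
        by measurable
      \<comment> \<open>Here the explicit choice of the least index pays off: the index is a
        measurable function of \<open>x\<close> with countably many values, so evaluating
        \<open>y x\<close> at it, and then taking the limit in \<open>m\<close>, preserves
        measurability.\<close>
      have "(\<lambda>x. y x (LEAST j. dist (D (N x) j) (\<xi> x) < inverse (real (Suc m)))) \<in> borel_measurable M" for m
        by (rule measurable_compose_countable[OF y_meas]) measurable
      then have [measurable]: "(\<lambda>x. dense_extension (D (N x)) (y x) (\<xi> x)) \<in> borel_measurable M"
        unfolding dense_extension_def by measurable
      show "(\<lambda>x. A x (\<xi> x)) \<in> borel_measurable (restrict_space M (space M))"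
        unfolding A_def by (intro measurable_restrict_space1) measurable
    qed
  next
    fix \<xi> assume \<xi>: "\<xi> \<in> \<H>"
    \<comment> \<open>The null set may now depend on \<open>\<xi>\<close>, since \<open>A\<close> is
      already fixed. At a good point, the distances of \<open>\<Phi> \<xi> x\<close> to all
      prescribed values determine it as the value of the extension.\<close>
    have "AE x in M. \<forall>n j. norm (1 *\<^sub>C \<Phi> \<xi> x + (-1) *\<^sub>C \<Phi> (\<delta> n j) x) \<le> C * norm (1 *\<^sub>C \<xi> x + (-1) *\<^sub>C \<delta> n j x)"
      unfolding AE_all_countable by (intro allI \<Phi>_bound2[OF \<xi> \<delta> \<xi>])
    then show "AE x in M. \<Phi> \<xi> x = A x (\<xi> x)"
      using AE_not_in[OF Z] AE_space
    proof eventually_elim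
      fix x assume le: "\<forall>n j. norm (1 *\<^sub>C \<Phi> \<xi> x + (-1) *\<^sub>C \<Phi> (\<delta> n j) x) \<le> C * norm (1 *\<^sub>C \<xi> x + (-1) *\<^sub>C \<delta> n j x)"
        and "x \<notin> Z" and x: "x \<in> space M"
      have "dense_extension (D (N x)) (y x) (\<xi> x) = \<Phi> \<xi> x"
      proof (rule ext(2)[OF x x x x x \<open>x \<notin> Z\<close>])
        show "\<xi> x \<in> fibre K N x"
          using \<xi> x by (simp add: \<H>_def direct_integralD)
        show "norm (\<Phi> \<xi> x - y x j) \<le> C * norm (\<xi> x - D (N x) j)" for j
          using le[rule_format, of "N x" j] by (simp add: y_def \<delta>_def scaleC.minus_left)
      qed
      then show "\<Phi> \<xi> x = A x (\<xi> x)"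
        using \<open>x \<notin> Z\<close> by (simp add: A_def)
    qed
  qed
qed

section \<open>Representations in standard form\<close>

lemma lshift_prepend [simp]: "lshift (prepend i x) = x"
  by (simp add: lshift_def prepend_def)

lemma prepend_lshift: "prepend (x 0) (lshift x) = x"
  by (auto simp: prepend_def lshift_def split: nat.split)

lemma lshift_Omega: "x \<in> Omega d \<Longrightarrow> lshift x \<in> Omega d"
  by (simp add: Omega_def lshift_def)

lemma measurable_coordinate [measurable]:
  "(\<lambda>x. x k) \<in> measurable (Omega_borel d) (count_space UNIV)"
proof -
  have "(\<lambda>x. x k) \<in> measurable borel (borel :: nat measure)"
    by (intro borel_measurable_continuous_onI continuous_on_product_coordinates)
  then show ?thesis
    unfolding Omega_borel_def by (intro measurable_restrict_space1)
      (simp add: measurable_cong_sets[OF refl sets_borel_eq_count_space])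
qed

lemma measurable_lshift [measurable]: "lshift \<in> measurable (Omega_borel d) (Omega_borel d)"
proof -
  have "continuous_on UNIV lshift"
    unfolding lshift_def
    by (intro continuous_on_coordinatewise_then_product continuous_on_product_coordinates)
  then have "lshift \<in> borel_measurable borel"
    by (rule borel_measurable_continuous_onI)
  then show ?thesis
    unfolding Omega_borel_def
    by (intro measurable_restrict_space3) (auto simp: lshift_Omega)
qed

locale standard_representation =
  fixes d :: nat and \<mu> :: "(nat \<Rightarrow> nat) measure"
    and K :: "enat \<Rightarrow> 'h::{chilbert_space, second_countable_topology} set"
    and N :: "(nat \<Rightarrow> nat) \<Rightarrow> enat" and U :: "(nat \<Rightarrow> nat) \<Rightarrow> 'h \<Rightarrow> 'h"
    and S :: "nat \<Rightarrow> ((nat \<Rightarrow> nat) \<Rightarrow> 'h) \<Rightarrow> ((nat \<Rightarrow> nat) \<Rightarrow> 'h)"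
  assumes standard: "standard_form d \<mu> K N U S"
begin

abbreviation "\<H> \<equiv> direct_integral \<mu> (fibre K N)"

sublocale prob_space \<mu>
  using standard by (simp add: standard_form_def)

lemma sets_\<mu> [measurable_cong]: "sets \<mu> = sets (Omega_borel d)"
  using standard by (simp add: standard_form_def)

lemma space_\<mu>: "space \<mu> = Omega d"
  using sets_eq_imp_space_eq[OF sets_\<mu>] by (simp add: space_Omega_borel)

lemma N_measurable [measurable]: "N \<in> measurable \<mu> (count_space UNIV)"
  using standard by (simp add: standard_form_def)

lemma fibre_closed: "x \<in> space \<mu> \<Longrightarrow> closed_csubspace (fibre K N x)"
  by (rule has_hilbert_dim_closed_csubspace[of _ "N x"])
    (use standard in \<open>simp add: standard_form_def space_\<mu>\<close>)

lemma U_linear: "x \<in> space \<mu> \<Longrightarrow> bounded_clinear_between (fibre K N x) (fibre K N x) (U x)"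
  using standard by (auto simp: standard_form_def space_\<mu> unitary_between_def)

lemma AE_fibre_lshift: "AE x in \<mu>. fibre K N (lshift x) = fibre K N x"
  using standard by (auto simp: standard_form_def fibre_def)

text \<open>Quasi-invariance under the shift says exactly that preimages of null sets are null. This
  allows one identity to be used at \<open>x\<close> and at \<open>lshift x\<close>
  together.\<close>

lemma AE_lshift:
  assumes "AE x in \<mu>. P x"
  shows "AE x in \<mu>. P (lshift x)"
proof -
  obtain Z where Z: "{x \<in> space \<mu>. \<not> P x} \<subseteq> Z" "emeasure \<mu> Z = 0" "Z \<in> sets \<mu>"
    using assms by (rule AE_E)
  show ?thesis
  proof (rule AE_I)
    show "{x \<in> space \<mu>. \<not> P (lshift x)} \<subseteq> lshift -` Z \<inter> space \<mu>"
      using Z(1) lshift_Omega unfolding space_\<mu> by blast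
    show "emeasure \<mu> (lshift -` Z \<inter> space \<mu>) = 0"
      using standard Z(2,3) by (auto simp: standard_form_def shift_quasi_invariant_def)
    show "lshift -` Z \<inter> space \<mu> \<in> sets \<mu>"
      using Z(3) by (rule measurable_sets[rotated]) measurable
  qed
qed

lemma S_formula:
  assumes "i \<in> {1..d}" "\<xi> \<in> \<H>"
  shows "AE x in \<mu>. S i \<xi> x = (if x 0 = i then rho \<mu> x *\<^sub>R U x (\<xi> (lshift x)) else 0)"
  using standard assms by (simp add: standard_form_def)

lemma prepend_measurable: "i \<in> {1..d} \<Longrightarrow> prepend i \<in> measurable \<mu> \<mu>"
  using measurable_prepend measurable_cong_sets[OF sets_\<mu> sets_\<mu>] by blast

lemma density_RN_prepend:
  assumes i: "i \<in> {1..d}"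
  shows "density \<mu> (RN_deriv \<mu> (distr \<mu> \<mu> (prepend i))) = distr \<mu> \<mu> (prepend i)"
proof (rule density_RN_deriv)
  show "absolutely_continuous \<mu> (distr \<mu> \<mu> (prepend i))"
    using standard i prepend_measurable[OF i]
    by (auto simp: absolutely_continuous_def null_sets_def emeasure_distr standard_form_def
        prepend_quasi_invariant_def)
qed simp

text \<open>Let \<open>E\<close> be the set where the derivative of branch \<open>i\<close>
  vanishes. Its preimage \<open>F\<close> under \<open>prepend i\<close> is null, hence so is the
  preimage of \<open>F\<close> under the shift, and that contains \<open>E\<close>. Finiteness of
  the derivative matters too, since \<open>enn2real\<close> sends infinity to 0.\<close>

lemma AE_rho_pos: "AE x in \<mu>. 0 < rho \<mu> x"
proof -
  have "AE x in \<mu>. x 0 = i \<longrightarrow> 0 < rho \<mu> x" if i: "i \<in> {1..d}" for i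
  proof -
    let ?R = "RN_deriv \<mu> (distr \<mu> \<mu> (prepend i))"
    note [measurable] = prepend_measurable[OF i]
    define E where "E = {x \<in> space \<mu>. x 0 = i \<and> ?R x = 0}"
    define F where "F = prepend i -` E \<inter> space \<mu>"
    have E [measurable]: "E \<in> sets \<mu>"
      unfolding E_def by measurable
    have [measurable]: "F \<in> sets \<mu>"
      unfolding F_def by measurable
    have "emeasure \<mu> F = emeasure (density \<mu> ?R) E"
      unfolding F_def density_RN_prepend[OF i] by (simp add: emeasure_distr)
    also have "\<dots> = (\<integral>\<^sup>+x. ?R x * indicator E x \<partial>\<mu>)"
      by (rule emeasure_density) measurable
    also have "\<dots> = (\<integral>\<^sup>+x. 0 \<partial>\<mu>)"
      by (rule nn_integral_cong) (simp add: E_def indicator_def)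
    finally have "AE x in \<mu>. x \<notin> F"
      by (intro AE_not_in null_setsI) auto
    then have "AE x in \<mu>. lshift x \<notin> F"
      by (rule AE_lshift)
    moreover have "AE x in \<mu>. ?R x \<noteq> \<infinity>"
    proof (rule RN_deriv_finite)
      interpret distr: prob_space "distr \<mu> \<mu> (prepend i)"
        by (rule prob_space_distr) measurable
      show "sigma_finite_measure (distr \<mu> \<mu> (prepend i))" ..
      show "absolutely_continuous \<mu> (distr \<mu> \<mu> (prepend i))"
        using absolutely_continuousI_density[of ?R \<mu>] density_RN_prepend[OF i] by simp
    qed simp
    ultimately show ?thesis
      using AE_space
    proof eventually_elim
      fix x assume F: "lshift x \<notin> F" and fin: "?R x \<noteq> \<infinity>" and x: "x \<in> space \<mu>"
      show "x 0 = i \<longrightarrow> 0 < rho \<mu> x"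
      proof
        assume x0: "x 0 = i"
        then have "prepend i (lshift x) = x"
          using prepend_lshift[of x] by simp
        then have "?R x \<noteq> 0"
          using F x x0 by (auto simp: F_def E_def space_\<mu> lshift_Omega)
        then show "0 < rho \<mu> x"
          using fin x0 by (simp add: rho_def enn2real_positive_iff less_top zero_less_iff_neq_zero)
      qed
    qed
  qed
  then have "AE x in \<mu>. \<forall>i\<in>{1..d}. x 0 = i \<longrightarrow> 0 < rho \<mu> x"
    by (intro AE_finite_allI) auto
  then show ?thesis
    using AE_space by eventually_elim (auto simp: space_\<mu> Omega_def)
qed

lemma S_operator: "i \<in> {1..d} \<Longrightarrow> direct_integral_operator \<mu> \<mu> (fibre K N) (fibre K N) (S i)"
  using standard unfolding standard_form_def cuntz_representation_def
  by (auto intro!: direct_integral_operator.intro fibre_closed)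

lemma S_range: "i \<in> {1..d} \<Longrightarrow> \<xi> \<in> \<H> \<Longrightarrow> S i \<xi> \<in> \<H>"
  by (rule direct_integral_operator.range_T[OF S_operator])

lemma indicator_in: "\<xi> \<in> \<H> \<Longrightarrow> E \<in> sets \<mu> \<Longrightarrow> (\<lambda>x. indicator E x *\<^sub>R \<xi> x) \<in> \<H>"
  by (rule direct_integral_indicator[OF fibre_closed])

text \<open>At each point the indicator is a real scalar and passes through \<open>U x\<close>,
  which is linear on the fibre at \<open>x\<close> only. The value \<open>\<xi> (lshift x)\<close>
  lies there because fibres are almost everywhere invariant under the shift.\<close>

lemma S_indicator:
  assumes i: "i \<in> {1..d}" and \<xi>: "\<xi> \<in> \<H>" and E: "E \<in> sets \<mu>"
  shows "AE x in \<mu>. S i (\<lambda>y. indicator E y *\<^sub>R \<xi> y) x = indicator E (lshift x) *\<^sub>R S i \<xi> x"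
  using S_formula[OF i \<xi>] S_formula[OF i indicator_in[OF \<xi> E]]
    AE_fibre_lshift AE_space
proof eventually_elim
  case (elim x)
  then have "\<xi> (lshift x) \<in> fibre K N x"
    using direct_integralD(2)[OF \<xi>, of "lshift x"] by (simp add: space_\<mu> lshift_Omega)
  with elim show ?case
    by (simp add: bounded_clinear_betweenD(4)[OF U_linear])
qed

text \<open>The witness is the adjoint \<open>R i\<close> applied to \<open>\<xi>\<close>. In the
  resolution of \<open>\<xi>\<close> as the sum of all \<open>S j (R j \<xi>)\<close>, the term for
  \<open>j\<close> is supported on sequences starting with \<open>j\<close>, so at \<open>x\<close>
  only the term for \<open>x 0\<close> survives.\<close>

lemma S_preimage:
  assumes i: "i \<in> {1..d}" and \<xi>: "\<xi> \<in> \<H>"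
  obtains \<zeta> where "\<zeta> \<in> \<H>" "AE x in \<mu>. S i \<zeta> x = indicator {x \<in> Omega d. x 0 = i} x *\<^sub>R \<xi> x"
proof -
  have "cuntz_representation d \<mu> (fibre K N) S"
    using standard by (simp add: standard_form_def)
  then obtain R where R_op: "\<forall>i\<in>{1..d}. di_bounded_operator \<mu> (fibre K N) \<mu> (fibre K N) (R i)"
    and sum: "\<forall>\<xi>\<in>\<H>. AE x in \<mu>. (\<Sum>i=1..d. S i (R i \<xi>) x) = \<xi> x"
    unfolding cuntz_representation_def by blast
  have R: "R j \<xi> \<in> \<H>" if "j \<in> {1..d}" for j
    using R_op that \<xi> by (simp add: di_bounded_operator_def)
  have "AE x in \<mu>. \<forall>j\<in>{1..d}. x 0 \<noteq> j \<longrightarrow> S j (R j \<xi>) x = 0"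
  proof (rule AE_finite_allI)
    fix j assume j: "j \<in> {1..d}"
    show "AE x in \<mu>. x 0 \<noteq> j \<longrightarrow> S j (R j \<xi>) x = 0"
      using S_formula[OF j R[OF j]] by eventually_elim simp
  qed simp
  with sum[rule_format, OF \<xi>] AE_space
  have "AE x in \<mu>. S i (R i \<xi>) x = indicator {x \<in> Omega d. x 0 = i} x *\<^sub>R \<xi> x"
  proof eventually_elim
    case (elim x)
    show ?case
    proof (cases "x 0 = i")
      case True
      have "(\<Sum>j=1..d. S j (R j \<xi>) x) = (\<Sum>j\<in>{i}. S j (R j \<xi>) x)"
        by (rule sum.mono_neutral_right) (use i True elim in auto)
      with elim True show ?thesis
        by (simp add: space_\<mu>)
    qed (use i elim in simp)
  qed
  with R[OF i] show ?thesis
    by (rule that)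
qed

end

section \<open>Two representations whose measures are equivalent on an invariant set\<close>

locale equivalent_representations =
  rep: standard_representation d \<mu> K N U S + rep': standard_representation d \<mu>' K' N' U' S'
  for d :: nat and \<mu> \<mu>' :: "(nat \<Rightarrow> nat) measure"
    and K :: "enat \<Rightarrow> 'h::{chilbert_space, second_countable_topology} set"
    and K' :: "enat \<Rightarrow> 'k::{chilbert_space, second_countable_topology} set"
    and N N' U U' S S' +
  fixes X :: "(nat \<Rightarrow> nat) set"
  assumes X_sets [measurable]: "X \<in> sets (Omega_borel d)" and X_invariant: "shift_invariant d X"
    and equivalent: "\<And>E. E \<in> sets (Omega_borel d) \<Longrightarrow> E \<subseteq> X \<Longrightarrow> emeasure \<mu> E = 0 \<longleftrightarrow> emeasure \<mu>' E = 0"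
begin

abbreviation G :: "(nat \<Rightarrow> nat) \<Rightarrow> ennreal" where
  "G \<equiv> RN_deriv \<mu> (density \<mu>' (indicator X))"

abbreviation g :: "(nat \<Rightarrow> nat) \<Rightarrow> real" where
  "g x \<equiv> sqrt (enn2real (G x))"

lemma change_measure_eq: "change_measure \<mu> \<mu>' X \<eta> x = g x *\<^sub>R \<eta> x"
  by (simp add: change_measure_def)

lemma lshift_X_iff: "x \<in> Omega d \<Longrightarrow> lshift x \<in> X \<longleftrightarrow> x \<in> X"
  using X_invariant by (auto simp: shift_invariant_def)

text \<open>Inside \<open>X\<close> both measures have the same null sets, so it suffices to cut an
  exceptional set to \<open>X\<close>. The auxiliary claim names the measures generically in order
  to serve both directions.\<close>

lemma AE_on_X_iff: "(AE x in \<mu>. x \<in> X \<longrightarrow> P x) \<longleftrightarrow> (AE x in \<mu>'. x \<in> X \<longrightarrow> P x)"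
proof -
  have *: "AE x in \<nu>'. x \<in> X \<longrightarrow> P x"
    if AE: "AE x in \<nu>. x \<in> X \<longrightarrow> P x"
      and sets: "sets \<nu> = sets (Omega_borel d)" "sets \<nu>' = sets (Omega_borel d)"
      and null: "\<And>E. E \<in> sets (Omega_borel d) \<Longrightarrow> E \<subseteq> X \<Longrightarrow> emeasure \<nu> E = 0 \<Longrightarrow> emeasure \<nu>' E = 0"
    for \<nu> \<nu>'
  proof -
    have sp: "space \<nu>' = space \<nu>"
      by (rule sets_eq_imp_space_eq) (simp add: sets)
    obtain Z where Z: "{x \<in> space \<nu>. \<not> (x \<in> X \<longrightarrow> P x)} \<subseteq> Z" "emeasure \<nu> Z = 0" "Z \<in> sets \<nu>"
      using AE by (rule AE_E)
    have "emeasure \<nu> (Z \<inter> X) = 0"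
      using emeasure_mono[of "Z \<inter> X" Z \<nu>] Z by simp
    then have "emeasure \<nu>' (Z \<inter> X) = 0"
      using Z(3) X_sets sets by (intro null) auto
    moreover have "Z \<inter> X \<in> sets \<nu>'"
      using Z(3) X_sets sets by auto
    ultimately show ?thesis
      using Z(1) sp by (intro AE_I[of _ _ "Z \<inter> X"]) auto
  qed
  show ?thesis
    using *[OF _ rep.sets_\<mu> rep'.sets_\<mu>] *[OF _ rep'.sets_\<mu> rep.sets_\<mu>] equivalent by blast
qed

lemma density_G: "density \<mu> G = density \<mu>' (indicator X)"
proof (rule rep.density_RN_deriv)
  show "absolutely_continuous \<mu> (density \<mu>' (indicator X))"
    unfolding absolutely_continuous_def
  proof
    fix E assume E: "E \<in> null_sets \<mu>"
    then have "AE x in \<mu>. x \<in> X \<longrightarrow> x \<notin> E"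
      using AE_not_in[OF E] by eventually_elim simp
    then have "AE x in \<mu>'. x \<in> X \<longrightarrow> x \<notin> E"
      by (simp add: AE_on_X_iff)
    with E show "E \<in> null_sets (density \<mu>' (indicator X))"
      by (subst null_sets_density_iff)
        (auto simp: rep.sets_\<mu> rep'.sets_\<mu> indicator_def elim!: eventually_mono)
  qed
qed (simp add: rep.sets_\<mu> rep'.sets_\<mu>)

text \<open>A density is nonzero almost everywhere for the measure that it defines, here
  \<open>\<mu>'\<close> restricted to \<open>X\<close>; equivalence on \<open>X\<close> carries this
  over to \<open>\<mu>\<close>. Finiteness of that measure excludes the value infinity, at which
  \<open>g\<close> would be 0.\<close>

lemma AE_g_pos: "AE x in \<mu>. x \<in> X \<longrightarrow> 0 < g x"
proof -
  have "AE x in \<mu>'. x \<in> X \<longrightarrow> G x \<noteq> 0"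
  proof -
    have "AE x in density \<mu> G. G x \<noteq> 0"
      by (subst AE_density) (auto intro!: AE_I2)
    then show ?thesis
      unfolding density_G by (subst (asm) AE_density) (auto elim!: eventually_mono)
  qed
  moreover have "AE x in \<mu>. G x \<noteq> \<infinity>"
  proof (rule rep.RN_deriv_finite)
    have "finite_measure (density \<mu>' (indicator X))"
      by (rule finite_measureI) (simp add: emeasure_density)
    then show "sigma_finite_measure (density \<mu>' (indicator X))"
      by (rule finite_measure.axioms(1))
    show "absolutely_continuous \<mu> (density \<mu>' (indicator X))"
      using absolutely_continuousI_density[of G \<mu>] by (simp add: density_G)
  qed (simp add: rep.sets_\<mu> rep'.sets_\<mu>)
  ultimately show ?thesis
    unfolding AE_on_X_iff[symmetric]
    by eventually_elim (simp add: enn2real_positive_iff less_top zero_less_iff_neq_zero)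
qed

end

text \<open>Change of variables along the branch \<open>prepend i\<close>: for
  \<open>i = x 0\<close> its Jacobian is the square of \<open>rho \<mu> x\<close>.\<close>

lemma (in standard_representation) nn_integral_RN_prepend:
  assumes i: "i \<in> {1..d}" and [measurable]: "f \<in> borel_measurable \<mu>"
  shows "(\<integral>\<^sup>+x. RN_deriv \<mu> (distr \<mu> \<mu> (prepend i)) x * f x \<partial>\<mu>) = (\<integral>\<^sup>+x. f (prepend i x) \<partial>\<mu>)"
proof -
  note [measurable] = prepend_measurable[OF i]
  have "(\<integral>\<^sup>+x. RN_deriv \<mu> (distr \<mu> \<mu> (prepend i)) x * f x \<partial>\<mu>)
      = (\<integral>\<^sup>+x. f x \<partial>density \<mu> (RN_deriv \<mu> (distr \<mu> \<mu> (prepend i))))"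
    by (subst nn_integral_density) auto
  also have "\<dots> = (\<integral>\<^sup>+x. f (prepend i x) \<partial>\<mu>)"
    unfolding density_RN_prepend[OF i] by (subst nn_integral_distr) auto
  finally show ?thesis .
qed

context equivalent_representations
begin

text \<open>Both sides are the derivative of \<open>E \<mapsto> \<mu>' (lshift ` E)\<close> with respect to \<open>\<mu>\<close> on \<open>X\<close>.\<close>

lemma RN_cocycle:
  assumes i: "i \<in> {1..d}"
  shows "AE x in \<mu>. x \<in> X \<longrightarrow> x 0 = i \<longrightarrow>
    RN_deriv \<mu> (distr \<mu> \<mu> (prepend i)) x * G (lshift x) = G x * RN_deriv \<mu>' (distr \<mu>' \<mu>' (prepend i)) x"
proof -
  let ?R = "RN_deriv \<mu> (distr \<mu> \<mu> (prepend i))" and ?R' = "RN_deriv \<mu>' (distr \<mu>' \<mu>' (prepend i))"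
  have [measurable]: "?R' \<in> borel_measurable \<mu>" "G \<in> borel_measurable \<mu>'"
    using borel_measurable_RN_deriv[of \<mu>' "distr \<mu>' \<mu>' (prepend i)"]
      borel_measurable_RN_deriv[of \<mu> "density \<mu>' (indicator X)"]
    by measurable
  define B where "B = {x \<in> X. x 0 = i}"
  have B [measurable]: "B \<in> sets (Omega_borel d)"
  proof -
    have "B = X \<inter> {x \<in> space (Omega_borel d). x 0 = i}"
      using sets.sets_into_space[OF X_sets] by (auto simp: B_def)
    then show ?thesis by simp
  qed
  \<comment> \<open>Uniqueness of densities reduces the pointwise identity to equality of two
    measures. On \<open>E\<close>, both reduce to the \<open>\<mu>'\<close>-integral of
    \<open>?I (prepend i x)\<close>.\<close>
  have "density \<mu> (\<lambda>x. ?R x * G (lshift x) * indicator B x) = density \<mu> (\<lambda>x. G x * ?R' x * indicator B x)"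
  proof (rule measure_eqI)
    fix E assume "E \<in> sets (density \<mu> (\<lambda>x. ?R x * G (lshift x) * indicator B x))"
    then have E [measurable]: "E \<in> sets (Omega_borel d)"
      by (simp add: rep.sets_\<mu>)
    let ?I = "indicator (B \<inter> E) :: _ \<Rightarrow> ennreal"
    have [measurable]: "(\<lambda>x. ?I (prepend i x)) \<in> borel_measurable \<mu>"
      "(\<lambda>x. ?I (prepend i x)) \<in> borel_measurable \<mu>'"
      by (rule measurable_compose[OF rep.prepend_measurable[OF i]]
          measurable_compose[OF rep'.prepend_measurable[OF i]]; measurable)+
    \<comment> \<open>By invariance, \<open>prepend i x\<close> lies in \<open>X\<close> exactly
      when its shift \<open>x\<close> does, so the indicator of \<open>X\<close> that
      \<open>G\<close> introduces at the shifted point is already implied by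
      \<open>?I\<close>.\<close>
    have X: "?I (prepend i x) = indicator X x * ?I (prepend i x)" if "x \<in> Omega d" for x
    proof -
      have "prepend i x \<in> Omega d"
        using measurable_space[OF measurable_prepend[OF i]] that by (simp add: space_Omega_borel)
      then show ?thesis
        using lshift_X_iff[of "prepend i x"] by (simp add: indicator_def B_def)
    qed
    have "emeasure (density \<mu> (\<lambda>x. ?R x * G (lshift x) * indicator B x)) E
        = (\<integral>\<^sup>+x. ?R x * (G (lshift x) * ?I x) \<partial>\<mu>)"
      by (subst emeasure_density) (auto intro!: nn_integral_cong simp: indicator_def)
    also have "\<dots> = (\<integral>\<^sup>+x. G x * ?I (prepend i x) \<partial>\<mu>)"
      by (subst rep.nn_integral_RN_prepend[OF i]) auto
    also have "\<dots> = (\<integral>\<^sup>+x. ?I (prepend i x) \<partial>density \<mu> G)"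
      by (subst nn_integral_density) auto
    also have "\<dots> = (\<integral>\<^sup>+x. indicator X x * ?I (prepend i x) \<partial>\<mu>')"
      unfolding density_G by (subst nn_integral_density) auto
    also have "\<dots> = (\<integral>\<^sup>+x. ?I (prepend i x) \<partial>\<mu>')"
      using X by (intro nn_integral_cong) (simp add: rep'.space_\<mu>)
    also have "\<dots> = (\<integral>\<^sup>+x. ?R' x * ?I x \<partial>\<mu>')"
      by (rule rep'.nn_integral_RN_prepend[OF i, symmetric]) measurable
    also have "\<dots> = (\<integral>\<^sup>+x. indicator X x * (?R' x * ?I x) \<partial>\<mu>')"
      by (intro nn_integral_cong) (simp add: indicator_def B_def)
    also have "\<dots> = (\<integral>\<^sup>+x. ?R' x * ?I x \<partial>density \<mu> G)"
      unfolding density_G by (subst nn_integral_density) auto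
    also have "\<dots> = (\<integral>\<^sup>+x. G x * (?R' x * ?I x) \<partial>\<mu>)"
      by (subst nn_integral_density) auto
    also have "\<dots> = emeasure (density \<mu> (\<lambda>x. G x * ?R' x * indicator B x)) E"
      by (subst emeasure_density) (auto intro!: nn_integral_cong simp: indicator_def)
    finally show "emeasure (density \<mu> (\<lambda>x. ?R x * G (lshift x) * indicator B x)) E
        = emeasure (density \<mu> (\<lambda>x. G x * ?R' x * indicator B x)) E" .
  qed simp
  then have "AE x in \<mu>. ?R x * G (lshift x) * indicator B x = G x * ?R' x * indicator B x"
    by (subst (asm) rep.density_unique_iff) auto
  then show ?thesis
    by eventually_elim (auto simp: B_def indicator_def)
qed

text \<open>\<open>rho\<close> selects its branch by the first letter of \<open>x\<close>, so the
  identities of the finitely many branches are put on one null set before square roots are taken at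
  \<open>i = x 0\<close>.\<close>

lemma rho_cocycle: "AE x in \<mu>. x \<in> X \<longrightarrow> rho \<mu> x * g (lshift x) = g x * rho \<mu>' x"
proof -
  have "AE x in \<mu>. \<forall>i\<in>{1..d}. x \<in> X \<longrightarrow> x 0 = i \<longrightarrow>
    RN_deriv \<mu> (distr \<mu> \<mu> (prepend i)) x * G (lshift x) = G x * RN_deriv \<mu>' (distr \<mu>' \<mu>' (prepend i)) x"
    by (intro AE_finite_allI RN_cocycle) auto
  then show ?thesis
    using AE_space
  proof eventually_elim
    case (elim x)
    then have "x 0 \<in> {1..d}"
      by (simp add: rep.space_\<mu> Omega_def)
    then show ?case
      using elim by (auto simp: rho_def simp flip: real_sqrt_mult enn2real_mult)
  qed
qed

text \<open>Conjugation by \<open>g\<close> replaces the factor \<open>rho \<mu>'\<close> by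
  \<open>rho \<mu>\<close>: the cocycle identity moves \<open>g\<close> across the shift. Both
  representations then carry the same scalar factor, which cancels when they are compared.\<close>

lemma S'_transferred:
  assumes i: "i \<in> {1..d}" and \<eta>: "\<eta> \<in> rep'.\<H>"
  shows "AE x in \<mu>. x \<in> X \<longrightarrow>
    g x *\<^sub>R S' i \<eta> x = (if x 0 = i then rho \<mu> x *\<^sub>R U' x (g (lshift x) *\<^sub>R \<eta> (lshift x)) else 0)"
proof -
  have "AE x in \<mu>'. x \<in> X \<longrightarrow>
      S' i \<eta> x = (if x 0 = i then rho \<mu>' x *\<^sub>R U' x (\<eta> (lshift x)) else 0)
      \<and> fibre K' N' (lshift x) = fibre K' N' x"
    using rep'.S_formula[OF i \<eta>] rep'.AE_fibre_lshift by eventually_elim simp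
  then have "AE x in \<mu>. x \<in> X \<longrightarrow>
      S' i \<eta> x = (if x 0 = i then rho \<mu>' x *\<^sub>R U' x (\<eta> (lshift x)) else 0)
      \<and> fibre K' N' (lshift x) = fibre K' N' x"
    by (simp only: AE_on_X_iff)
  with rho_cocycle AE_space show ?thesis
  proof eventually_elim
    case (elim x)
    have x: "x \<in> space \<mu>'" "lshift x \<in> space \<mu>'"
      using elim by (auto simp: rep.space_\<mu> rep'.space_\<mu> lshift_Omega)
    show ?case
    proof
      assume "x \<in> X"
      with elim x have "\<eta> (lshift x) \<in> fibre K' N' x"
        using direct_integralD(2)[OF \<eta>, of "lshift x"] by simp
      with elim x \<open>x \<in> X\<close> show "g x *\<^sub>R S' i \<eta> x
          = (if x 0 = i then rho \<mu> x *\<^sub>R U' x (g (lshift x) *\<^sub>R \<eta> (lshift x)) else 0)"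
        by (simp add: bounded_clinear_betweenD(4)[OF rep'.U_linear])
    qed
  qed
qed

end

section \<open>Intertwiners\<close>

locale intertwining_operator = equivalent_representations d \<mu> \<mu>' K K' N N' U U' S S' X
  for d :: nat and \<mu> \<mu>' :: "(nat \<Rightarrow> nat) measure"
    and K :: "enat \<Rightarrow> 'h::{chilbert_space, second_countable_topology} set"
    and K' :: "enat \<Rightarrow> 'k::{chilbert_space, second_countable_topology} set"
    and N N' U U' S S' X +
  fixes T :: "((nat \<Rightarrow> nat) \<Rightarrow> 'h) \<Rightarrow> ((nat \<Rightarrow> nat) \<Rightarrow> 'k)"
  assumes T_op: "di_bounded_operator \<mu> (fibre K N) \<mu>' (fibre K' N') T"
    and intertwining: "intertwiner d \<mu> (fibre K N) S \<mu>' S' T"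
begin

sublocale direct_integral_operator \<mu> \<mu>' "fibre K N" "fibre K' N'" T
  by standard
    (use T_op rep.fibre_closed rep'.fibre_closed in
      \<open>auto simp: rep.sets_\<mu> rep'.sets_\<mu> rep.space_\<mu> rep'.space_\<mu>\<close>)

lemma T_S:
  "i \<in> {1..d} \<Longrightarrow> \<xi> \<in> rep.\<H> \<Longrightarrow> AE x in \<mu>'. T (S i \<xi>) x = S' i (T \<xi>) x"
  using intertwining by (simp add: intertwiner_def)

section \<open>Locality of intertwiners: from first letters to Borel sets\<close>

lemma first_letter_sets [measurable]: "{x \<in> Omega d. x 0 = i} \<in> sets \<mu>"
proof -
  have "{x \<in> space \<mu>. x 0 = i} \<in> sets \<mu>"
    by measurable
  then show ?thesis by (simp add: rep.space_\<mu>)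
qed

text \<open>The part of \<open>\<xi>\<close> with first letter \<open>j\<close> is
  \<open>S j \<zeta>\<close> for some \<open>\<zeta>\<close>, so \<open>T\<close> maps it to
  \<open>S' j (T \<zeta>)\<close>, which again lives on first letter \<open>j\<close>. These images
  sum to \<open>T \<xi>\<close>; at a point with first letter \<open>i\<close> only the image for
  \<open>i\<close> remains.\<close>

lemma first_letter_commuting:
  assumes i: "i \<in> {1..d}"
  shows "{x \<in> Omega d. x 0 = i} \<in> commuting_sets"
  unfolding commuting_sets_def
proof (intro CollectI conjI ballI first_letter_sets)
  fix \<xi> assume \<xi>: "\<xi> \<in> rep.\<H>"
  let ?\<xi> = "\<lambda>j x. indicator {x \<in> Omega d. x 0 = j} x *\<^sub>R \<xi> x"
  have in_\<H>: "?\<xi> j \<in> rep.\<H>" for j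
    by (intro rep.indicator_in \<xi> first_letter_sets)
  have "AE x in \<mu>'. \<forall>j\<in>{1..d}. x 0 \<noteq> j \<longrightarrow> T (?\<xi> j) x = 0"
  proof (rule AE_finite_allI)
    fix j assume j: "j \<in> {1..d}"
    obtain \<zeta> where \<zeta>: "\<zeta> \<in> rep.\<H>" and S\<zeta>: "AE x in \<mu>. S j \<zeta> x = ?\<xi> j x"
      by (rule rep.S_preimage[OF j \<xi>])
    have "AE x in \<mu>'. T (S j \<zeta>) x = T (?\<xi> j) x"
      by (intro T_cong_AE rep.S_range in_\<H> S\<zeta> \<zeta> j)
    with T_S[OF j \<zeta>] rep'.S_formula[OF j range_T[OF \<zeta>]]
    show "AE x in \<mu>'. x 0 \<noteq> j \<longrightarrow> T (?\<xi> j) x = 0"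
      by eventually_elim auto
  qed simp
  moreover have "AE x in \<mu>'. T (\<lambda>x. \<Sum>j\<in>{1..d}. ?\<xi> j x) x = (\<Sum>j\<in>{1..d}. T (?\<xi> j) x)"
    by (intro T_sum in_\<H>) simp
  moreover have "AE x in \<mu>'. T (\<lambda>x. \<Sum>j\<in>{1..d}. ?\<xi> j x) x = T \<xi> x"
  proof (intro T_cong_AE direct_integral_sum rep.fibre_closed in_\<H> \<xi> AE_I2)
    fix x assume "x \<in> space \<mu>"
    then have x: "x \<in> Omega d" "x 0 \<in> {1..d}"
      by (auto simp: rep.space_\<mu> Omega_def)
    then have "(\<Sum>j\<in>{1..d}. ?\<xi> j x) = (\<Sum>j\<in>{x 0}. ?\<xi> j x)"
      by (intro sum.mono_neutral_right) auto
    with x show "(\<Sum>j\<in>{1..d}. ?\<xi> j x) = \<xi> x"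
      by simp
  qed simp_all
  ultimately show "AE x in \<mu>'. T (?\<xi> i) x = indicator {x \<in> Omega d. x 0 = i} x *\<^sub>R T \<xi> x"
    using AE_space
  proof eventually_elim
    case (elim x)
    show ?case
    proof (cases "x 0 = i")
      case True
      have "(\<Sum>j\<in>{1..d}. T (?\<xi> j) x) = (\<Sum>j\<in>{i}. T (?\<xi> j) x)"
        by (rule sum.mono_neutral_right) (use i elim True in auto)
      with elim True show ?thesis
        by (simp add: rep'.space_\<mu>)
    qed (use i elim in simp)
  qed
qed

text \<open>\<open>S i\<close> turns multiplication by the indicator of \<open>E\<close> into multiplication by the indicator of
  \<open>lshift -` E\<close>. It is applied to \<open>\<zeta> = S\<^sub>i\<^sup>* \<xi>\<close>.\<close>

lemma preimage_commuting:
  assumes i: "i \<in> {1..d}" and E: "E \<in> commuting_sets"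
  shows "{x \<in> Omega d. x 0 = i \<and> lshift x \<in> E} \<in> commuting_sets" (is "?E \<in> _")
  unfolding commuting_sets_def
proof (intro CollectI conjI ballI)
  note E_sets [measurable] = commuting_setsD(1)[OF E]
  have "{x \<in> space \<mu>. x 0 = i \<and> lshift x \<in> E} \<in> sets \<mu>"
    by measurable
  then show E'_sets: "?E \<in> sets \<mu>"
    by (simp add: rep.space_\<mu>)
  interpret S: direct_integral_operator \<mu> \<mu> "fibre K N" "fibre K N" "S i"
    by (rule rep.S_operator[OF i])
  interpret S': direct_integral_operator \<mu>' \<mu>' "fibre K' N'" "fibre K' N'" "S' i"
    by (rule rep'.S_operator[OF i])
  fix \<xi> assume \<xi>: "\<xi> \<in> rep.\<H>"
  obtain \<zeta> where \<zeta>: "\<zeta> \<in> rep.\<H>"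
    and S\<zeta>: "AE x in \<mu>. S i \<zeta> x = indicator {x \<in> Omega d. x 0 = i} x *\<^sub>R \<xi> x"
    by (rule rep.S_preimage[OF i \<xi>])
  let ?\<zeta> = "\<lambda>x. indicator E x *\<^sub>R \<zeta> x"
  have \<zeta>E: "?\<zeta> \<in> rep.\<H>"
    by (rule rep.indicator_in[OF \<zeta> E_sets])
  have T\<zeta>E: "(\<lambda>x. indicator E x *\<^sub>R T \<zeta> x) \<in> rep'.\<H>"
    using range_T[OF \<zeta>] E_sets by (intro rep'.indicator_in) (auto simp: sets_eq)
  have "AE x in \<mu>. S i ?\<zeta> x = indicator ?E x *\<^sub>R \<xi> x"
    using rep.S_indicator[OF i \<zeta> E_sets] S\<zeta>
    by eventually_elim (auto simp: indicator_def)
  then have "AE x in \<mu>'. T (S i ?\<zeta>) x = T (\<lambda>x. indicator ?E x *\<^sub>R \<xi> x) x"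
    by (intro T_cong_AE rep.S_range rep.indicator_in i \<zeta>E \<xi> E'_sets)
  moreover have "AE x in \<mu>'. T (S i ?\<zeta>) x = S' i (T ?\<zeta>) x"
    by (rule T_S[OF i \<zeta>E])
  moreover have "AE x in \<mu>'. S' i (T ?\<zeta>) x = S' i (\<lambda>x. indicator E x *\<^sub>R T \<zeta> x) x"
    by (intro S'.T_cong_AE range_T \<zeta>E T\<zeta>E commuting_setsD(2)[OF E \<zeta>])
  moreover have "AE x in \<mu>'. S' i (\<lambda>x. indicator E x *\<^sub>R T \<zeta> x) x = indicator E (lshift x) *\<^sub>R S' i (T \<zeta>) x"
    using E_sets by (intro rep'.S_indicator[OF i range_T[OF \<zeta>]]) (simp add: sets_eq)
  moreover have "AE x in \<mu>'. T (S i \<zeta>) x = S' i (T \<zeta>) x"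
    by (rule T_S[OF i \<zeta>])
  moreover have "AE x in \<mu>'. T (S i \<zeta>) x = T (\<lambda>x. indicator {x \<in> Omega d. x 0 = i} x *\<^sub>R \<xi> x) x"
    by (intro T_cong_AE rep.S_range rep.indicator_in i \<zeta> \<xi> first_letter_sets S\<zeta>)
  moreover have "AE x in \<mu>'. T (\<lambda>x. indicator {x \<in> Omega d. x 0 = i} x *\<^sub>R \<xi> x) x
      = indicator {x \<in> Omega d. x 0 = i} x *\<^sub>R T \<xi> x"
    by (rule commuting_setsD(2)[OF first_letter_commuting[OF i] \<xi>])
  ultimately show "AE x in \<mu>'. T (\<lambda>x. indicator ?E x *\<^sub>R \<xi> x) x = indicator ?E x *\<^sub>R T \<xi> x"
    by eventually_elim (auto simp: indicator_def)
qed

text \<open>Coordinate \<open>Suc k\<close> of \<open>x\<close> is coordinate \<open>k\<close> of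
  \<open>lshift x\<close>, so the induction step takes preimages under the shift, one for each
  possible first letter, and forms their finite union.\<close>

lemma coordinate_commuting: "{x \<in> Omega d. x k = i} \<in> commuting_sets"
proof -
  interpret sigma_algebra "space \<mu>" commuting_sets
    by (rule sigma_algebra_commuting_sets)
  show ?thesis
  proof (cases "i \<in> {1..d}")
    case False
    then have "{x \<in> Omega d. x k = i} = {}"
      by (auto simp: Omega_def)
    then show ?thesis by (simp only: empty_sets)
  next
    case True
    then show ?thesis
    proof (induction k)
      case 0
      then show ?case by (rule first_letter_commuting)
    next
      case (Suc k)
      have "{x \<in> Omega d. x (Suc k) = i}
          = (\<Union>j\<in>{1..d}. {x \<in> Omega d. x 0 = j \<and> lshift x \<in> {x \<in> Omega d. x k = i}})"
        by (auto simp: lshift_Omega) (auto simp: lshift_def Omega_def)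
      also have "\<dots> \<in> commuting_sets"
        using Suc by (intro finite_UN preimage_commuting) auto
      finally show ?case .
    qed
  qed
qed

text \<open>Relative to the sigma-algebra of commuting sets all coordinates are measurable. Hence so
  is the inclusion into the product space, and preimages of Borel sets under it are the Borel sets
  of \<open>Omega d\<close>.\<close>

lemma all_sets_commuting: "sets \<mu> \<subseteq> commuting_sets"
proof
  define \<Sigma> where "\<Sigma> = sigma (space \<mu>) commuting_sets"
  interpret sigma_algebra "space \<mu>" commuting_sets
    by (rule sigma_algebra_commuting_sets)
  have \<Sigma>: "space \<Sigma> = Omega d" "sets \<Sigma> = commuting_sets"
    by (simp_all add: \<Sigma>_def rep.space_\<mu>[symmetric] space_closed)
  have "(\<lambda>x. x k) \<in> measurable \<Sigma> (borel :: nat measure)" for k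
  proof -
    have "(\<lambda>x. x k) \<in> measurable \<Sigma> (count_space UNIV)"
      unfolding measurable_count_space_eq2_countable
      using coordinate_commuting[of k] by (auto simp: \<Sigma> vimage_def Int_def conj_commute)
    then show ?thesis
      by (simp add: measurable_cong_sets[OF refl sets_borel_eq_count_space])
  qed
  then have id: "(\<lambda>x. x) \<in> measurable \<Sigma> borel"
    by (rule measurable_coordinatewise_then_product)
  fix E assume "E \<in> sets \<mu>"
  then obtain B where "B \<in> sets borel" "E = B \<inter> Omega d"
    by (auto simp: rep.sets_\<mu> Omega_borel_def sets_restrict_space)
  then show "E \<in> commuting_sets"
    using measurable_sets[OF id] by (force simp: \<Sigma>)
qed

end

section \<open>Fibre operators of an intertwiner and their covariance\<close>

context intertwining_operator
begin

lemma pointwise_decomposition: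
  obtains A where "measurable_operator_field \<mu> (space \<mu>) (fibre K N) (fibre K' N') A"
    "\<And>\<xi>. \<xi> \<in> rep.\<H> \<Longrightarrow> AE x in \<mu>. g x *\<^sub>R T \<xi> x = A x (\<xi> x)"
proof -
  have G_meas [measurable]: "G \<in> borel_measurable \<mu>"
    by (rule borel_measurable_RN_deriv)
  have X: "X \<in> sets \<mu>"
    by (simp add: rep.sets_\<mu>)
  obtain C where C: "0 \<le> C" "\<And>\<xi>. \<xi> \<in> rep.\<H> \<Longrightarrow> AE x in \<mu>. norm (g x *\<^sub>R T \<xi> x) \<le> C * norm (\<xi> x)"
    by (rule T_pointwise_bound[OF all_sets_commuting X G_meas density_G]) blast
  \<comment> \<open>Where \<open>G\<close> is positive, an identity valid for \<open>\<mu>'\<close>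
    is valid for \<open>\<mu>\<close>; where \<open>G\<close> vanishes, the factor \<open>g\<close>
    erases the difference.\<close>
  have transfer: "AE x in \<mu>. g x *\<^sub>R \<eta> x = g x *\<^sub>R \<zeta> x" if "AE x in \<mu>'. \<eta> x = \<zeta> x" for \<eta> \<zeta> :: "_ \<Rightarrow> 'k"
  proof -
    have "AE x in density \<mu> G. \<eta> x = \<zeta> x"
      unfolding density_G using that by (subst AE_density) auto
    then have "AE x in \<mu>. 0 < G x \<longrightarrow> \<eta> x = \<zeta> x"
      by (subst (asm) AE_density) auto
    then show ?thesis
      by eventually_elim (auto simp: zero_less_iff_neq_zero)
  qed
  show ?thesis
  proof (rule decomposable_if_pointwise_bounded[where \<Phi> = "\<lambda>\<xi> x. g x *\<^sub>R T \<xi> x" and M = \<mu> and K = K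
        and N = N and H' = "fibre K' N'"])
    show "finite_measure \<mu>"
      by (rule rep.finite_measure_axioms)
    show "N \<in> measurable \<mu> (count_space UNIV)"
      by (rule rep.N_measurable)
    show "closed_csubspace (fibre K N x)" "closed_csubspace (fibre K' N' x)" if "x \<in> space \<mu>" for x
      using that H H' by auto
    show "0 \<le> C"
      by (rule C)
    fix \<xi> assume \<xi>: "\<xi> \<in> rep.\<H>"
    note T\<xi> = range_T[OF \<xi>]
    have [measurable]: "T \<xi> \<in> borel_measurable \<mu>"
      using direct_integralD(1)[OF T\<xi>] by measurable
    show "(\<lambda>x. g x *\<^sub>R T \<xi> x) \<in> sections \<mu> (fibre K' N')"
      unfolding sections_def
      by (auto intro!: closed_csubspaceD(5)[OF H'] direct_integralD(2)[OF T\<xi>] simp: space_eq)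
    show "AE x in \<mu>. norm (g x *\<^sub>R T \<xi> x) \<le> C * norm (\<xi> x)"
      by (rule C(2)[OF \<xi>])
    show "AE x in \<mu>. g x *\<^sub>R T (\<lambda>x. a *\<^sub>C \<xi> x) x = a *\<^sub>C (g x *\<^sub>R T \<xi> x)" for a
      using transfer[OF T_scaleC[OF \<xi>, of a]] by eventually_elim (simp add: scaleC.scaleR_right)
    fix \<eta> assume \<eta>: "\<eta> \<in> rep.\<H>"
    show "AE x in \<mu>. g x *\<^sub>R T (\<lambda>x. \<xi> x + \<eta> x) x = g x *\<^sub>R T \<xi> x + g x *\<^sub>R T \<eta> x"
      using transfer[OF T_add[OF \<xi> \<eta>]] by eventually_elim (simp add: scaleR_add_right)
  qed (rule that)
qed

text \<open>Intertwining tested on \<open>\<xi>\<close> yields the relation at the single vector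
  \<open>\<xi> (lshift x)\<close>, once the positive factor \<open>rho \<mu> x\<close> is cancelled.
  Countably many sections give a dense set of such vectors in the fibre off one null set, and both
  sides are continuous there.\<close>

lemma covariance:
  assumes A: "\<And>x. x \<in> X \<Longrightarrow> bounded_clinear_between (fibre K N x) (fibre K' N' x) (A x)"
    and TA: "\<And>\<xi>. \<xi> \<in> rep.\<H> \<Longrightarrow> AE x in \<mu>. g x *\<^sub>R T \<xi> x = A x (\<xi> x)"
  shows "AE x in \<mu>. x \<in> X \<longrightarrow> (\<forall>v\<in>fibre K N x. A x (U x v) = U' x (A (lshift x) v))"
proof -
  have "\<forall>x\<in>space \<mu>. closed_csubspace (fibre K N x)"
    using H by blast
  then obtain D :: "enat \<Rightarrow> nat \<Rightarrow> 'h" where D_\<H>: "\<forall>n j. (\<lambda>x. if N x = n then D n j else 0) \<in> rep.\<H>"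
    and D_in: "\<forall>x\<in>space \<mu>. \<forall>j. D (N x) j \<in> fibre K N x"
    and D_dense: "\<forall>x\<in>space \<mu>. fibre K N x \<subseteq> closure (range (D (N x)))"
    by (rule dense_sections[OF rep.finite_measure_axioms rep.N_measurable])
  define \<delta> where "\<delta> n j x = (if N x = n then D n j else 0)" for n j x
  have \<delta>: "\<delta> n j \<in> rep.\<H>" for n j
    using D_\<H> by (simp add: \<delta>_def[abs_def])
  have on_sections: "AE x in \<mu>. x \<in> X \<longrightarrow> x 0 = i \<longrightarrow> A x (U x (\<xi> (lshift x))) = U' x (A (lshift x) (\<xi> (lshift x)))"
    if i: "i \<in> {1..d}" and \<xi>: "\<xi> \<in> rep.\<H>" for i \<xi>
  proof -
    have "AE x in \<mu>'. x \<in> X \<longrightarrow> T (S i \<xi>) x = S' i (T \<xi>) x"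
      using T_S[OF i \<xi>] by eventually_elim simp
    then have "AE x in \<mu>. x \<in> X \<longrightarrow> T (S i \<xi>) x = S' i (T \<xi>) x"
      by (simp only: AE_on_X_iff)
    with TA[OF rep.S_range[OF i \<xi>]] rep.S_formula[OF i \<xi>] S'_transferred[OF i range_T[OF \<xi>]]
      rep.AE_lshift[OF TA[OF \<xi>]] rep.AE_rho_pos rep.AE_fibre_lshift AE_space
    show ?thesis
    proof eventually_elim
      case (elim x)
      show ?case
      proof (intro impI)
        assume x: "x \<in> X" "x 0 = i"
        have "\<xi> (lshift x) \<in> fibre K N x"
          using direct_integralD(2)[OF \<xi>, of "lshift x"] elim by (simp add: rep.space_\<mu> lshift_Omega)
        then have U\<xi>: "U x (\<xi> (lshift x)) \<in> fibre K N x"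
          using rep.U_linear[of x] elim by (auto dest: bounded_clinear_betweenD(1))
        have "rho \<mu> x *\<^sub>R A x (U x (\<xi> (lshift x))) = A x (S i \<xi> x)"
          using elim x bounded_clinear_betweenD(4)[OF A[OF x(1)] U\<xi>] by simp
        also have "\<dots> = rho \<mu> x *\<^sub>R U' x (A (lshift x) (\<xi> (lshift x)))"
          using elim x by simp
        finally show "A x (U x (\<xi> (lshift x))) = U' x (A (lshift x) (\<xi> (lshift x)))"
          using elim by simp
      qed
    qed
  qed
  have "AE x in \<mu>. \<forall>n j. \<forall>i\<in>{1..d}. x \<in> X \<longrightarrow> x 0 = i \<longrightarrow>
      A x (U x (\<delta> n j (lshift x))) = U' x (A (lshift x) (\<delta> n j (lshift x)))"
    unfolding AE_all_countable by (intro allI AE_finite_allI on_sections \<delta>) auto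
  \<comment> \<open>Equal fibres would not be enough here: \<open>\<delta> n j\<close> selects its
    support by dimension, and its value at \<open>lshift x\<close> has to be
    \<open>D (N x) j\<close>.\<close>
  moreover have "AE x in \<mu>. N (lshift x) = N x"
    using rep.standard by (simp add: standard_form_def)
  moreover have "AE x in \<mu>. x \<in> X \<longrightarrow> N' (lshift x) = N' x"
  proof -
    have "AE x in \<mu>'. N' (lshift x) = N' x"
      using rep'.standard by (simp add: standard_form_def)
    then have "AE x in \<mu>'. x \<in> X \<longrightarrow> N' (lshift x) = N' x"
      by eventually_elim simp
    then show ?thesis
      by (simp only: AE_on_X_iff)
  qed
  ultimately show ?thesis
    using AE_space
  proof eventually_elim
    case (elim x)
    show ?case
    proof (intro impI ballI)
      fix v assume x: "x \<in> X" and v: "v \<in> fibre K N x"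
      have x': "lshift x \<in> X" "x 0 \<in> {1..d}" "x \<in> space \<mu>'"
        using elim x lshift_X_iff by (auto simp: rep.space_\<mu> rep'.space_\<mu> Omega_def)
      have fib: "fibre K N (lshift x) = fibre K N x" "fibre K' N' (lshift x) = fibre K' N' x"
        using elim x by (auto simp: fibre_def)
      note closed = rep.fibre_closed[OF elim(4)]
      note lin = A[OF x] rep.U_linear[OF elim(4)] rep'.U_linear[OF x'(3)] A[OF x'(1), unfolded fib]
      have on_D: "A x (U x (D (N x) j)) = U' x (A (lshift x) (D (N x) j))" for j
        using elim(1)[rule_format, OF x'(2) x refl, of "N x" j] elim(2) by (simp add: \<delta>_def)
      have "v \<in> closure (range (D (N x)))"
        using bspec[OF D_dense elim(4)] v by blast
      then obtain f where f: "\<And>n. f n \<in> range (D (N x))" "f \<longlonglongrightarrow> v"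
        unfolding closure_sequential by blast
      have f_in: "f n \<in> fibre K N x" for n
        using f(1)[of n] bspec[OF D_in elim(4)] by auto
      have "A x (U x (f n)) = U' x (A (lshift x) (f n))" for n
        using f(1)[of n] on_D by auto
      moreover have "(\<lambda>n. A x (U x (f n))) \<longlonglongrightarrow> A x (U x v)"
        by (intro bounded_clinear_between_tendsto[OF lin(1) closed]
            bounded_clinear_between_tendsto[OF lin(2) closed] bounded_clinear_betweenD(1)[OF lin(2)] f_in v f(2))
      moreover have "(\<lambda>n. U' x (A (lshift x) (f n))) \<longlonglongrightarrow> U' x (A (lshift x) v)"
        by (intro bounded_clinear_between_tendsto[OF lin(3) rep'.fibre_closed[OF x'(3)]]
            bounded_clinear_between_tendsto[OF lin(4) closed] bounded_clinear_betweenD(1)[OF lin(4)] f_in v f(2))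
      ultimately show "A x (U x v) = U' x (A (lshift x) v)"
        by (simp add: LIMSEQ_unique)
    qed
  qed
qed

end

text \<open>On \<open>X\<close> the computation behind covariance is run backwards and ends with a
  division by \<open>g\<close>, which is positive there. Off \<open>X\<close> both sides vanish:
  \<open>T\<close> has no values there, and \<open>S' i (T \<xi>)\<close> reads
  \<open>T \<xi>\<close> at \<open>lshift x\<close>, which is also off \<open>X\<close> by
  invariance.\<close>

lemma (in equivalent_representations) intertwiner_if_covariant:
  assumes op: "di_bounded_operator \<mu> (fibre K N) \<mu>' (fibre K' N') T"
    and A: "\<And>x. x \<in> X \<Longrightarrow> bounded_clinear_between (fibre K N x) (fibre K' N' x) (A x)"
    and T: "decomposes_over \<mu> (fibre K N) \<mu>' X T A"
    and cov: "AE x in \<mu>. x \<in> X \<longrightarrow> (\<forall>v\<in>fibre K N x. A x (U x v) = U' x (A (lshift x) v))"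
  shows "intertwiner d \<mu> (fibre K N) S \<mu>' S' T"
  unfolding intertwiner_def
proof (intro ballI)
  fix i \<xi> assume i: "i \<in> {1..d}" and \<xi>: "\<xi> \<in> rep.\<H>"
  have TA: "AE x in \<mu>. x \<in> X \<longrightarrow> g x *\<^sub>R T \<eta> x = A x (\<eta> x)"
    and off_X: "AE x in \<mu>'. x \<notin> X \<longrightarrow> T \<eta> x = 0" if "\<eta> \<in> rep.\<H>" for \<eta>
    using T that by (auto simp: decomposes_over_def change_measure_eq)
  have T\<xi>: "T \<xi> \<in> rep'.\<H>"
    using op \<xi> by (simp add: di_bounded_operator_def)
  have "AE x in \<mu>. x \<in> X \<longrightarrow> T (S i \<xi>) x = S' i (T \<xi>) x"
    using TA[OF rep.S_range[OF i \<xi>]] rep.S_formula[OF i \<xi>] S'_transferred[OF i T\<xi>]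
      rep.AE_lshift[OF TA[OF \<xi>]] AE_g_pos rep.AE_fibre_lshift cov AE_space
  proof eventually_elim
    case (elim x)
    show ?case
    proof
      assume x: "x \<in> X"
      have x': "lshift x \<in> X"
        using elim x lshift_X_iff by (simp add: rep.space_\<mu>)
      have \<xi>x: "\<xi> (lshift x) \<in> fibre K N x"
        using direct_integralD(2)[OF \<xi>, of "lshift x"] elim by (simp add: rep.space_\<mu> lshift_Omega)
      then have U\<xi>: "U x (\<xi> (lshift x)) \<in> fibre K N x"
        using rep.U_linear[of x] elim by (auto dest: bounded_clinear_betweenD(1))
      have "A x 0 = 0"
        by (rule bounded_clinear_betweenD(5)[OF A[OF x] rep.fibre_closed]) (use elim in simp)
      then have "A x (S i \<xi> x) = (if x 0 = i then rho \<mu> x *\<^sub>R A x (U x (\<xi> (lshift x))) else 0)"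
        using elim(2) bounded_clinear_betweenD(4)[OF A[OF x] U\<xi>] by simp
      also have "\<dots> = g x *\<^sub>R S' i (T \<xi>) x"
        using elim(3,4,7) x x' \<xi>x by simp
      finally have "g x *\<^sub>R T (S i \<xi>) x = g x *\<^sub>R S' i (T \<xi>) x"
        using elim(1) x by simp
      moreover have "g x \<noteq> 0"
        using elim(5) x by auto
      ultimately show "T (S i \<xi>) x = S' i (T \<xi>) x"
        by (rule scaleR_left_imp_eq[rotated])
    qed
  qed
  then have "AE x in \<mu>'. x \<in> X \<longrightarrow> T (S i \<xi>) x = S' i (T \<xi>) x"
    by (simp only: AE_on_X_iff)
  with off_X[OF rep.S_range[OF i \<xi>]] rep'.AE_lshift[OF off_X[OF \<xi>]] rep'.S_formula[OF i T\<xi>] AE_space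
  show "AE x in \<mu>'. T (S i \<xi>) x = S' i (T \<xi>) x"
  proof eventually_elim
    case (elim x)
    show ?case
    proof (cases "x \<in> X")
      case False
      have "U' x 0 = 0"
        using elim(4) by (intro bounded_clinear_betweenD(5)[OF rep'.U_linear rep'.fibre_closed])
      with elim False show ?thesis
        using lshift_X_iff[of x] by (auto simp: rep'.space_\<mu>)
    qed (use elim in simp)
  qed
qed

theorem theorem1p4:
  fixes d :: nat
    and \<mu> \<mu>' :: "(nat \<Rightarrow> nat) measure"
    and K :: "enat \<Rightarrow> 'h::{chilbert_space, second_countable_topology} set"
    and K' :: "enat \<Rightarrow> 'k::{chilbert_space, second_countable_topology} set"
    and N N' :: "(nat \<Rightarrow> nat) \<Rightarrow> enat"
    and U :: "(nat \<Rightarrow> nat) \<Rightarrow> 'h \<Rightarrow> 'h"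
    and U' :: "(nat \<Rightarrow> nat) \<Rightarrow> 'k \<Rightarrow> 'k"
    and S :: "nat \<Rightarrow> ((nat \<Rightarrow> nat) \<Rightarrow> 'h) \<Rightarrow> ((nat \<Rightarrow> nat) \<Rightarrow> 'h)"
    and S' :: "nat \<Rightarrow> ((nat \<Rightarrow> nat) \<Rightarrow> 'k) \<Rightarrow> ((nat \<Rightarrow> nat) \<Rightarrow> 'k)"
    and T :: "((nat \<Rightarrow> nat) \<Rightarrow> 'h) \<Rightarrow> ((nat \<Rightarrow> nat) \<Rightarrow> 'k)"
    and \<Omega>0 \<Omega>1 \<Omega>2 :: "(nat \<Rightarrow> nat) set"
  assumes "2 \<le> d"
    and "standard_form d \<mu> K N U S"
    and "standard_form d \<mu>' K' N' U' S'"
    and "\<Omega>0 \<in> sets (Omega_borel d)" "\<Omega>1 \<in> sets (Omega_borel d)" "\<Omega>2 \<in> sets (Omega_borel d)"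
    and "shift_invariant d \<Omega>0" "shift_invariant d \<Omega>1" "shift_invariant d \<Omega>2"
    and "\<Omega>0 \<union> \<Omega>1 \<union> \<Omega>2 = Omega d"
    and "\<Omega>0 \<inter> \<Omega>1 = {}" "\<Omega>0 \<inter> \<Omega>2 = {}" "\<Omega>1 \<inter> \<Omega>2 = {}"
    and "\<forall>E\<in>sets (Omega_borel d). E \<subseteq> \<Omega>0 \<longrightarrow> (emeasure \<mu> E = 0 \<longleftrightarrow> emeasure \<mu>' E = 0)"
    and "emeasure \<mu>' \<Omega>1 = 0" and "emeasure \<mu> \<Omega>2 = 0"
    and "di_bounded_operator \<mu> (fibre K N) \<mu>' (fibre K' N') T"
  shows "intertwiner d \<mu> (fibre K N) S \<mu>' S' T \<longleftrightarrow>
    (\<exists>A. measurable_operator_field \<mu> \<Omega>0 (fibre K N) (fibre K' N') A \<and>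
         decomposes_over \<mu> (fibre K N) \<mu>' \<Omega>0 T A \<and>
         (AE x in \<mu>. x \<in> \<Omega>0 \<longrightarrow> (\<forall>v\<in>fibre K N x. A x (U x v) = U' x (A (lshift x) v))))"
    (is "?intertwiner \<longleftrightarrow> (\<exists>A. ?decomposition A)")
proof
  interpret equivalent_representations d \<mu> \<mu>' K K' N N' U U' S S' \<Omega>0
    by unfold_locales (use assms in auto)
  {
    assume "\<exists>A. ?decomposition A"
    then show ?intertwiner
      using intertwiner_if_covariant assms(17) by (auto simp: measurable_operator_field_def)
  }
  assume ?intertwiner
  then interpret intertwining_operator d \<mu> \<mu>' K K' N N' U U' S S' \<Omega>0 T
    by unfold_locales (use assms in auto)
  \<comment> \<open>The field is built over all of \<open>Omega d\<close>, with \<open>g\<close>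
    vanishing almost everywhere off \<Omega>0; the decomposition keeps its restriction to
    \<Omega>0.\<close>
  obtain A where field: "measurable_operator_field \<mu> (space \<mu>) (fibre K N) (fibre K' N') A"
    and TA: "\<And>\<xi>. \<xi> \<in> rep.\<H> \<Longrightarrow> AE x in \<mu>. g x *\<^sub>R T \<xi> x = A x (\<xi> x)"
    by (rule pointwise_decomposition) blast
  have sub: "\<Omega>0 \<subseteq> space \<mu>"
    using assms by (auto simp: rep.space_\<mu>)
  have "measurable_operator_field \<mu> \<Omega>0 (fibre K N) (fibre K' N') A"
    unfolding measurable_operator_field_def
  proof (intro conjI ballI)
    show "bounded_clinear_between (fibre K N x) (fibre K' N' x) (A x)" if "x \<in> \<Omega>0" for x
      using field sub that by (auto simp: measurable_operator_field_def)
    have sets: "sets (restrict_space \<mu> (space \<mu>)) = sets \<mu>"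
      using sets.sets_into_space[of _ \<mu>] by (auto simp: sets_restrict_space_iff)
    show "(\<lambda>x. A x (\<xi> x)) \<in> borel_measurable (restrict_space \<mu> \<Omega>0)" if "\<xi> \<in> sections \<mu> (fibre K N)" for \<xi>
      using field that
      by (intro measurable_restrict_space1)
        (auto simp: measurable_operator_field_def measurable_cong_sets[OF sets refl])
  qed
  have not1: "AE x in \<mu>'. x \<notin> \<Omega>1" and not2: "AE x in \<mu>. x \<notin> \<Omega>2"
    using assms by (auto intro!: AE_not_in null_setsI simp: rep.sets_\<mu> rep'.sets_\<mu>)
  have T_indicator: "AE x in \<mu>'. T (\<lambda>x. indicator E x *\<^sub>R \<xi> x) x = indicator E x *\<^sub>R T \<xi> x"
    if "E \<in> sets (Omega_borel d)" "\<xi> \<in> rep.\<H>" for E \<xi>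
    using all_sets_commuting that by (intro commuting_setsD(2)) (auto simp: rep.sets_\<mu>)
  have "decomposes_over \<mu> (fibre K N) \<mu>' \<Omega>0 T A"
    unfolding decomposes_over_def
  proof (intro conjI ballI impI)
    fix \<xi> assume \<xi>: "\<xi> \<in> rep.\<H>"
    have \<xi>E: "(\<lambda>x. indicator E x *\<^sub>R \<xi> x) \<in> rep.\<H>" if "E \<in> sets (Omega_borel d)" for E
      using that by (intro rep.indicator_in \<xi>) (simp add: rep.sets_\<mu>)
    show "AE x in \<mu>. x \<in> \<Omega>0 \<longrightarrow> change_measure \<mu> \<mu>' \<Omega>0 (T \<xi>) x = A x (\<xi> x)"
      using TA[OF \<xi>] by eventually_elim (simp add: change_measure_eq)
    \<comment> \<open>Off \<Omega>0 only \<Omega>2 carries mass of \<open>\<mu>'\<close>. By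
      locality, \<open>T \<xi>\<close> there is the image of \<open>\<xi>\<close> cut to \<Omega>2,
      which is the zero vector because \<Omega>2 is null for \<open>\<mu>\<close>.\<close>
    have "AE x in \<mu>'. T (\<lambda>x. indicator \<Omega>2 x *\<^sub>R \<xi> x) x = 0"
      using not2 by (intro T_eq_zero \<xi>E assms) (auto elim!: eventually_mono simp: indicator_def)
    with not1 T_indicator[OF assms(6) \<xi>] AE_space
    show "AE x in \<mu>'. x \<notin> \<Omega>0 \<longrightarrow> T \<xi> x = 0"
    proof eventually_elim
      case (elim x)
      then have "x \<notin> \<Omega>0 \<Longrightarrow> x \<in> \<Omega>2"
        using assms(10) by (auto simp: rep'.space_\<mu>)
      with elim show ?case by auto
    qed
    \<comment> \<open>The same localisation, now to \<Omega>0, treats the remaining points; off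
      \<Omega>0 the image is already known to vanish.\<close>
    moreover assume "AE x in \<mu>. x \<in> \<Omega>0 \<longrightarrow> \<xi> x = 0"
    then have "AE x in \<mu>'. T (\<lambda>x. indicator \<Omega>0 x *\<^sub>R \<xi> x) x = 0"
      by (intro T_eq_zero \<xi>E assms) (auto elim!: eventually_mono simp: indicator_def)
    with T_indicator[OF assms(4) \<xi>] have "AE x in \<mu>'. x \<in> \<Omega>0 \<longrightarrow> T \<xi> x = 0"
      by eventually_elim auto
    ultimately show "AE x in \<mu>'. T \<xi> x = 0"
      by eventually_elim auto
  qed
  moreover have "AE x in \<mu>. x \<in> \<Omega>0 \<longrightarrow> (\<forall>v\<in>fibre K N x. A x (U x v) = U' x (A (lshift x) v))"
    using field sub by (intro covariance TA) (auto simp: measurable_operator_field_def)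
  moreover note \<open>measurable_operator_field \<mu> \<Omega>0 (fibre K N) (fibre K' N') A\<close>
  ultimately show "\<exists>A. ?decomposition A"
    by blast
qed

end
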